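(* Let $B \subseteq \mathbb{R}^n$ be a body and let $D$ be a finite set of bodies in $\mathbb{R}^n$. Then \[ \lim_{r \downarrow 0} \Delta_{\{rB\} \cup D} = \Delta_D + (1 - \Delta_D)\, \Delta_{\{B\}} . \]
   Context: A \emph{body} is a bounded subset of $\mathbb{R}^n$ that has nonempty interior and whose boundary has Lebesgue measure zero. For $r>0$, $rB = \{rx : x \in B\}$. A \emph{packing} using a set of bodies $D$ is a set $P$ of congruent copies $RB+t$ (with $B \in D$, $R \in O(n)$, $t \in \mathbb{R}^n$) of elements of $D$ such that the interiors of distinct members of $P$ are pairwise disjoint. Its carrier is $|P| = \bigcup P$, the union of its members. $\Sigma_D$ denotes the set of packings using bodies from $D$. For $S \subseteq \mathbb{R}^n$ the upper density is $\overline{\rho}(S) = \limsup_{r \to \infty} \lambda(S \cap rC)/r^n$, where $\lambda$ is Lebesgue measure on $\mathbb{R}^n$ and $C$ is the axis-aligned unit cube centered at the origin. The \emph{optimal packing density} for a set of bodies $D$ is $\Delta_D = \sup_{P \in \Sigma_D} \overline{\rho}(|P|)$. *)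

theory Defs
  imports "HOL-Analysis.Analysis"
begin

definition body :: "(real ^ 'n) set \<Rightarrow> bool" where
  "body B \<longleftrightarrow> bounded B \<and> interior B \<noteq> {} \<and> frontier B \<in> null_sets lebesgue"

definition dilate :: "real \<Rightarrow> (real ^ 'n) set \<Rightarrow> (real ^ 'n) set" where
  "dilate r B = (\<lambda>x. r *\<^sub>R x) ` B"

definition congruent_copy :: "(real ^ 'n) set \<Rightarrow> (real ^ 'n) set \<Rightarrow> bool" where
  "congruent_copy K B \<longleftrightarrow>
     (\<exists>R t. orthogonal_transformation R \<and> K = (\<lambda>x. R x + t) ` B)"

definition packings :: "(real ^ 'n) set set \<Rightarrow> (real ^ 'n) set set set" where
  "packings D = {P. (\<forall>K\<in>P. \<exists>B\<in>D. congruent_copy K B) \<and>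
     (\<forall>K\<in>P. \<forall>L\<in>P. K \<noteq> L \<longrightarrow> interior K \<inter> interior L = {})}"

definition unit_cube :: "(real ^ 'n) set" where
  "unit_cube = cbox (\<chi> i. - 1 / 2) (\<chi> i. 1 / 2)"

text \<open>Densities take values in the extended reals so that the limes superior and the supremum
  below are those of a complete lattice; no boundedness has to be presupposed. Carriers of
  packings by bodies are Lebesgue measurable, being countable unions of measurable sets.\<close>

definition upper_density :: "(real ^ 'n) set \<Rightarrow> ereal" where
  "upper_density S =
     Limsup at_top (\<lambda>r::real. ereal (measure lebesgue (S \<inter> dilate r unit_cube) / r ^ CARD('n)))"

definition packing_density :: "(real ^ 'n) set set \<Rightarrow> ereal" where
  "packing_density D = (SUP P\<in>packings D. upper_density (\<Union>P))"

end

theory Submission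
  imports Defs
begin

text \<open>For a finite set of bodies the optimal density is the supremum of \<open>\<lambda>(|P|) / s\<^sup>n\<close> over finite
  packings \<open>P\<close> inside a cube of side \<open>s\<close>: periodizing \<open>P\<close> gives one inequality, and the copies
  meeting a large cube lie in a slightly larger one, which gives the other.

  Upper bound: in a packing by \<open>D\<close> and small copies \<open>rB\<close>, cut space into cells of side \<open>\<eta>\<close> with
  \<open>r \<ll> \<eta> \<ll> 1\<close>. A cell meeting a small copy avoids the copies of bodies in \<open>D\<close> except near
  their boundaries, which have small measure because the boundary of a body is null. In each such
  cell the small copies have density at most about \<open>\<Delta>\<close> of \<open>{B}\<close>.

  Lower bound: in a dense finite packing by \<open>D\<close> in a cube, fill the grid cells contained in the
  open complement of the closures with scaled translates of one dense finite packing by \<open>B\<close>.\<close>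

section \<open>Cubes, grid cells and erosions\<close>

text \<open>If the copies from \<open>D\<close> take volume \<open>a\<close> out of a total volume
  \<open>T\<close>, the small copies fill at most the share \<delta> of the rest. The value
  \<open>a + \<delta> * (T - a)\<close> is nondecreasing in \<open>a\<close> because \<delta> \<le>
  1, so the extreme case is \<open>a = \<delta>' * T\<close>; this is the origin of the formula. The
  obstacle in the upper bound is that a cell meeting a small copy may also cut a copy from
  \<open>D\<close>, so volumes of cells and of copies cannot simply be added. Replacing each large
  copy by its erosion, the points at distance at least \<rho> from its complement, restores
  disjointness. Since erosion commutes with rigid motions and \<open>D\<close> is finite, one \<rho>
  loses at most the fraction \<open>e\<close> of every copy, in every packing. The parameters are
  chosen in the order \<open>e\<close>, \<rho>, \<eta>, \<open>r\<close>, so the threshold for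
  \<open>r\<close> does not depend on the packing. The bound by finite packings has no error term: a
  finite packing in a cube of side \<open>s\<close> has volume at most \<delta> times the volume of
  the cube, for every \<open>s\<close>. It can therefore be applied inside a single cell.\<close>

definition cube :: "real ^ 'n \<Rightarrow> real \<Rightarrow> (real ^ 'n) set" where
  "cube c s = cbox (c - (\<chi> i. s / 2)) (c + (\<chi> i. s / 2))"

lemma mem_cube: "x \<in> cube c s \<longleftrightarrow> (\<forall>i. \<bar>x $ i - c $ i\<bar> \<le> s / 2)"
proof -
  have "(c $ i - s / 2 \<le> x $ i \<and> x $ i \<le> c $ i + s / 2) = (\<bar>x $ i - c $ i\<bar> \<le> s / 2)" for i
    by linarith
  then show ?thesis by (simp add: cube_def mem_box_cart)
qed

lemma interior_cube: "interior (cube c s) = {x. \<forall>i. \<bar>x $ i - c $ i\<bar> < s / 2}"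
proof -
  have "(c $ i - s / 2 < x $ i \<and> x $ i < c $ i + s / 2) = (\<bar>x $ i - c $ i\<bar> < s / 2)" for x i
    by linarith
  then show ?thesis by (auto simp: cube_def mem_box_cart)
qed

lemma cube_lmeasurable [simp]: "cube c s \<in> lmeasurable"
  by (simp add: cube_def)

lemma bounded_cube [simp]: "bounded (cube c s)"
  by (simp add: cube_def)

lemma measure_cube: "0 \<le> s \<Longrightarrow> measure lebesgue (cube c s :: (real ^ 'n) set) = s ^ CARD('n)"
proof -
  assume s: "0 \<le> s"
  have "c \<in> cube c s" using s by (auto simp: mem_cube)
  then have "cbox (c - (\<chi> i. s / 2)) (c + (\<chi> i. s / 2)) \<noteq> {}"
    by (auto simp: cube_def)
  then show ?thesis by (simp add: cube_def content_cbox_cart)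
qed

lemma negligible_frontier_cube: "negligible (frontier (cube c s))"
  by (simp add: cube_def negligible_convex_frontier)

text \<open>Comparison with the l1 norm gives the factor n. Only proportionality to \<open>e\<close>
  matters below, so this constant stands for the cube diameter throughout.\<close>

lemma dist_le_coordinatewise:
  fixes x y :: "real ^ 'n" and e :: real
  assumes "\<And>i. \<bar>x $ i - y $ i\<bar> \<le> e"
  shows "dist x y \<le> CARD('n) * e"
proof -
  have "dist x y \<le> (\<Sum>i\<in>UNIV. \<bar>(x - y) $ i\<bar>)"
    unfolding dist_norm by (rule norm_le_l1_cart)
  also have "\<dots> \<le> CARD('n) * e"
    using sum_bounded_above[of UNIV "\<lambda>i. \<bar>(x - y) $ i\<bar>" e] assms by simp
  finally show ?thesis .
qed

lemma dist_cube:
  fixes x y :: "real ^ 'n" and s :: real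
  assumes "x \<in> cube c s" "y \<in> cube c s"
  shows "dist x y \<le> CARD('n) * s"
proof (rule dist_le_coordinatewise)
  fix i show "\<bar>x $ i - y $ i\<bar> \<le> s"
    using assms[unfolded mem_cube, rule_format, of i] by linarith
qed

lemma cube_near:
  fixes x y :: "real ^ 'n"
  assumes "x \<in> cube c s" "\<And>i. \<bar>y $ i - x $ i\<bar> \<le> d"
  shows "y \<in> cube c (s + 2 * d)"
  unfolding mem_cube
proof
  fix i show "\<bar>y $ i - c $ i\<bar> \<le> (s + 2 * d) / 2"
    using assms(1)[unfolded mem_cube, rule_format, of i] assms(2)[of i]
    unfolding add_divide_distrib nonzero_mult_div_cancel_left[OF zero_neq_numeral[symmetric]] by linarith
qed

lemma cube_near_dist:
  fixes x y :: "real ^ 'n"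
  assumes "x \<in> cube c s" "dist x y \<le> d"
  shows "y \<in> cube c (s + 2 * d)"
proof (rule cube_near[OF assms(1)])
  fix i show "\<bar>y $ i - x $ i\<bar> \<le> d"
    using assms(2) component_le_norm_cart[of "y - x" i] by (simp add: dist_norm norm_minus_commute)
qed

lemma cube_affine_image:
  assumes "0 < a"
  shows "(\<lambda>x. a *\<^sub>R x + v) ` cube c s = cube (a *\<^sub>R c + v) (a * s)"
proof -
  have 1: "a *\<^sub>R x + v \<in> cube (a *\<^sub>R c + v) (a * s) \<longleftrightarrow> x \<in> cube c s" for x
  proof -
    have "\<bar>a * x $ i - a * c $ i\<bar> \<le> a * s / 2 \<longleftrightarrow> \<bar>x $ i - c $ i\<bar> \<le> s / 2" for i
    proof -
      have "\<bar>a * x $ i - a * c $ i\<bar> = a * \<bar>x $ i - c $ i\<bar>"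
        using assms by (simp add: abs_mult right_diff_distrib[symmetric])
      then show ?thesis using assms
        by (metis mult_le_cancel_left_pos times_divide_eq_right)
    qed
    then show ?thesis by (simp add: mem_cube)
  qed
  have 2: "y = a *\<^sub>R ((1/a) *\<^sub>R (y - v)) + v" for y using assms by simp
  show ?thesis
  proof (intro equalityI subsetI)
    fix y assume "y \<in> cube (a *\<^sub>R c + v) (a * s)"
    then show "y \<in> (\<lambda>x. a *\<^sub>R x + v) ` cube c s"
      using 1[of "(1/a) *\<^sub>R (y - v)"] 2[of y] by (metis imageI)
  qed (auto simp: 1)
qed

lemma dilate_unit_cube: "0 < r \<Longrightarrow> dilate r (unit_cube :: (real ^ 'n) set) = cube 0 r"
proof -
  have "(unit_cube :: (real ^ 'n) set) = cube 0 1"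
    unfolding unit_cube_def cube_def by (intro arg_cong2[where f = cbox]) (auto simp: vec_eq_iff)
  then show "0 < r \<Longrightarrow> dilate r (unit_cube :: (real ^ 'n) set) = cube 0 r"
    using cube_affine_image[of r "0 :: real ^ 'n" 0 1] by (simp add: dilate_def)
qed

section \<open>The cubical grid of mesh \<open>h\<close>\<close>

abbreviation lattice_point :: "real \<Rightarrow> int ^ 'n \<Rightarrow> real ^ 'n" where
  "lattice_point h z \<equiv> h *\<^sub>R (\<chi> i. of_int (z $ i))"

definition cell :: "real \<Rightarrow> int ^ 'n \<Rightarrow> (real ^ 'n) set" where
  "cell h z = cube (lattice_point h z) h"

lemma cell_translate:
  fixes z :: "int ^ 'n"
  shows "cell h z = (+) (lattice_point h z) ` cube 0 h"
proof -
  have "(+) v ` S = (\<lambda>x. 1 *\<^sub>R x + v) ` S" for v :: "real ^ 'n" and S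
    by (intro image_cong) auto
  then show ?thesis
    unfolding cell_def by (simp only: cube_affine_image zero_less_one) simp
qed

lemma cells_cover:
  fixes x :: "real ^ 'n"
  assumes "0 < h"
  obtains z where "x \<in> cell h z"
proof
  define z :: "int ^ 'n" where "z = (\<chi> i. round (x $ i / h))"
  show "x \<in> cell h z"
    unfolding cell_def mem_cube
  proof
    fix i
    have "\<bar>of_int (round (x $ i / h)) - x $ i / h\<bar> \<le> 1/2"
      by (rule of_int_round_abs_le)
    then have "h * \<bar>of_int (round (x $ i / h)) - x $ i / h\<bar> \<le> h * (1/2)"
      using assms by (intro mult_left_mono) auto
    moreover have "h * \<bar>of_int (round (x $ i / h)) - x $ i / h\<bar> = \<bar>x $ i - h * of_int (round (x $ i / h))\<bar>"
    proof -
      have "h * \<bar>of_int (round (x $ i / h)) - x $ i / h\<bar> = \<bar>h * (of_int (round (x $ i / h)) - x $ i / h)\<bar>"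
        using assms by (simp add: abs_mult)
      also have "\<dots> = \<bar>x $ i - h * of_int (round (x $ i / h))\<bar>"
        using assms by (simp add: right_diff_distrib)
      finally show ?thesis .
    qed
    ultimately show "\<bar>x $ i - lattice_point h z $ i\<bar> \<le> h / 2"
      by (simp add: z_def)
  qed
qed

lemma interior_cells_disjoint:
  assumes "z \<noteq> w"
  shows "interior (cell h z) \<inter> interior (cell h w) = {}"
proof (rule ccontr)
  assume "interior (cell h z) \<inter> interior (cell h w) \<noteq> {}"
  then obtain x where x: "\<And>i. \<bar>x $ i - h * of_int (z $ i)\<bar> < h/2" "\<And>i. \<bar>x $ i - h * of_int (w $ i)\<bar> < h/2"
    by (auto simp: cell_def interior_cube)
  obtain i where i: "z $ i \<noteq> w $ i" using assms by (auto simp: vec_eq_iff)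
  have h: "h > 0" using x(1)[of i] by linarith
  have "\<bar>h * of_int (z $ i) - h * of_int (w $ i)\<bar> < h"
    using x(1)[of i] x(2)[of i] by linarith
  then have "h * \<bar>of_int (z $ i) - of_int (w $ i)\<bar> < h * (1::real)"
    using h by (simp add: abs_mult right_diff_distrib[symmetric])
  then have "\<bar>of_int (z $ i - w $ i)\<bar> < (1::real)" using h by simp
  with i show False by linarith
qed

lemma negligible_Int_if_interiors_disjoint:
  assumes "negligible (frontier S)" "negligible (frontier T)" "interior S \<inter> interior T = {}"
  shows "negligible (S \<inter> T)"
proof (rule negligible_subset)
  show "negligible (frontier S \<union> frontier T)" using assms by (simp add: negligible_Un_eq)
  show "S \<inter> T \<subseteq> frontier S \<union> frontier T"
    using assms(3) closure_subset by (auto simp: frontier_def)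
qed

lemma negligible_Int_cells:
  "z \<noteq> w \<Longrightarrow> negligible (cell h z \<inter> cell h w)"
  by (intro negligible_Int_if_interiors_disjoint interior_cells_disjoint)
     (auto simp: cell_def negligible_frontier_cube)

lemma cell_lmeasurable [simp]: "cell h z \<in> lmeasurable"
  by (simp add: cell_def)

text \<open>Each translate stays in its own cell, so different translates overlap only in shared
  faces. With \<open>S\<close> a full cube this computes the volume of a set of cells; with
  \<open>S\<close> the carrier of a finite packing, the volume of its periodization.\<close>

lemma measure_UN_translates:
  fixes S :: "(real ^ 'n) set"
  assumes "finite Z" "S \<in> lmeasurable" "S \<subseteq> cube 0 h"
  shows "measure lebesgue (\<Union>z\<in>Z. (+) (lattice_point h z) ` S) = card Z * measure lebesgue S"
proof -
  have sub: "(+) (lattice_point h z) ` S \<subseteq> cell h z" for z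
    unfolding cell_translate using assms(3) by auto
  have "measure lebesgue (\<Union>z\<in>Z. (+) (lattice_point h z) ` S)
     = (\<Sum>z\<in>Z. measure lebesgue ((+) (lattice_point h z) ` S))"
  proof (rule measure_negligible_finite_Union_image[OF assms(1)])
    show "pairwise (\<lambda>x y. negligible ((+) (lattice_point h x) ` S \<inter>
          (+) (lattice_point h y) ` S)) Z"
      using sub negligible_subset[OF negligible_Int_cells] unfolding pairwise_def
      by (meson Int_mono)
  qed (simp add: assms(2) measurable_translation)
  then show ?thesis by (simp add: measure_translation)
qed

lemma measure_UN_cells:
  fixes h :: real
  assumes "finite Z" "0 \<le> h"
  shows "measure lebesgue (\<Union>z\<in>Z. cell h z :: (real ^ 'n) set) = card Z * h ^ CARD('n)"
  unfolding cell_translate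
  using measure_UN_translates[OF assms(1), of "cube 0 h :: (real ^ 'n) set" h] assms(2) by (simp add: measure_cube)

lemma UN_cells_lmeasurable: "finite Z \<Longrightarrow> (\<Union>z\<in>Z. cell h z) \<in> lmeasurable"
  by (intro fmeasurable.finite_UN) auto

lemma finite_cells_meeting:
  fixes W :: "(real ^ 'n) set"
  assumes "bounded W" "0 < h"
  shows "finite {z. cell h z \<inter> W \<noteq> {}}"
proof -
  obtain b where b: "\<And>x. x \<in> W \<Longrightarrow> norm x \<le> b" using assms(1) by (auto simp: bounded_iff)
  \<comment> \<open>A cell centre differs by at most \<open>h / 2\<close> per coordinate from a
    point of norm at most \<open>b\<close>, so each index is at most \<open>b / h + 1/2\<close> in
    absolute value.\<close>
  define k where "k = \<lceil>b / h + 1/2\<rceil>"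
  have "{z. cell h z \<inter> W \<noteq> {}} \<subseteq> vec_lambda ` (UNIV \<rightarrow>\<^sub>E {-k..k})"
  proof
    fix z :: "int ^ 'n" assume "z \<in> {z. cell h z \<inter> W \<noteq> {}}"
    then obtain x where x: "x \<in> cell h z" "x \<in> W" by blast
    have "z $ i \<in> {-k..k}" for i
    proof -
      have "\<bar>x $ i - h * of_int (z $ i)\<bar> \<le> h/2" using x(1) by (auto simp: cell_def mem_cube)
      moreover have "\<bar>x $ i\<bar> \<le> b" using b[OF x(2)] component_le_norm_cart[of x i] by linarith
      ultimately have "\<bar>h * of_int (z $ i)\<bar> \<le> b + h/2" by linarith
      then have "h * \<bar>of_int (z $ i)\<bar> \<le> b + h/2" using assms(2) by (simp add: abs_mult)
      then have "\<bar>of_int (z $ i)\<bar> \<le> b / h + 1/2" using assms(2) by (simp add: field_simps)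
      then have "\<bar>z $ i\<bar> \<le> k" unfolding k_def by linarith
      then show ?thesis by auto
    qed
    then have "(\<lambda>i. z $ i) \<in> UNIV \<rightarrow>\<^sub>E {-k..k}" by auto
    then show "z \<in> vec_lambda ` (UNIV \<rightarrow>\<^sub>E {-k..k})" by (metis imageI vec_lambda_eta)
  qed
  then show ?thesis by (rule finite_subset) (simp add: finite_PiE)
qed

lemma cell_nonempty: "0 < h \<Longrightarrow> cell h z \<noteq> {}"
  using mem_cube[of "lattice_point h z" "lattice_point h z" h] by (auto simp: cell_def)

lemma finite_cells_inside:
  assumes "bounded U" "0 < h"
  shows "finite {z. cell h z \<subseteq> U}"
  using cell_nonempty[OF assms(2)] by (intro finite_subset[OF _ finite_cells_meeting[OF assms]]) blast

section \<open>Erosions and the cells inside an open set\<close>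

text \<open>Open balls are used so that the erosion is closed for every \<open>U\<close>; for
  bounded \<open>U\<close> and positive radius it is compact, hence measurable.\<close>

definition erosion :: "real \<Rightarrow> ('a::metric_space) set \<Rightarrow> 'a set" where
  "erosion \<rho> U = {x. ball x \<rho> \<subseteq> U}"

lemma closed_erosion: "closed (erosion \<rho> U)"
proof -
  have "- erosion \<rho> U = (\<Union>y\<in>-U. ball y \<rho>)"
    by (auto simp: erosion_def subset_iff dist_commute)
  then show ?thesis by (metis closed_open open_UN open_ball)
qed

lemma erosion_subset: "0 < \<rho> \<Longrightarrow> erosion \<rho> U \<subseteq> U"
  by (auto simp: erosion_def subset_iff)

lemma erosion_lmeasurable:
  fixes U :: "('a::euclidean_space) set"
  assumes "bounded U" "0 < \<rho>" shows "erosion \<rho> U \<in> lmeasurable"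
  using closed_erosion bounded_subset[OF assms(1) erosion_subset[OF assms(2)]]
  by (intro lmeasurable_compact) (simp add: compact_eq_bounded_closed)

text \<open>An open set is the increasing union of its erosions of radius \<open>1 / Suc k\<close>,
  so continuity of measure from below provides one good radius. Every smaller radius gives a larger
  erosion.\<close>

lemma erosion_exhausts:
  fixes U :: "('a::euclidean_space) set"
  assumes "open U" "bounded U" "0 < e"
  obtains d where "0 < d" "\<And>\<rho>. 0 < \<rho> \<Longrightarrow> \<rho> \<le> d \<Longrightarrow> measure lebesgue U - e < measure lebesgue (erosion \<rho> U)"
proof -
  define A where "A k = erosion (1 / Suc k) U" for k
  have Un: "(\<Union>k. A k) = U"
  proof (intro equalityI subsetI)
    fix x assume "x \<in> U"
    then obtain r where r: "0 < r" "ball x r \<subseteq> U" using assms(1) by (meson openE)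
    obtain k where "1 / Suc k < r" using r(1) by (metis nat_approx_posE)
    then have "x \<in> A k" using r(2) subset_ball[of "1 / Suc k" r x] by (auto simp: A_def erosion_def)
    then show "x \<in> (\<Union>k. A k)" by blast
  qed (use erosion_subset[of "1 / Suc _" U] in \<open>force simp: A_def\<close>)
  have U: "U \<in> lmeasurable" by (simp add: assms lmeasurable_open)
  have "(\<lambda>k. measure lebesgue (A k)) \<longlonglongrightarrow> measure lebesgue (\<Union>k. A k)"
  proof (rule Lim_measure_incseq)
    show "range A \<subseteq> sets lebesgue"
      using erosion_lmeasurable[OF assms(2)] by (auto simp: A_def)
    show "incseq A"
    proof (rule incseq_SucI)
      fix k have "ball x (1 / Suc (Suc k)) \<subseteq> ball x (1 / Suc k)" for x :: 'a
        by (intro subset_ball) (simp add: field_simps)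
      then show "A k \<subseteq> A (Suc k)" by (auto simp: A_def erosion_def simp del: of_nat_Suc)
    qed
    show "emeasure lebesgue (\<Union>k. A k) \<noteq> \<infinity>" using U Un by (auto simp: fmeasurable_def)
  qed
  then have "\<forall>\<^sub>F k in sequentially. measure lebesgue U - e < measure lebesgue (A k)"
    unfolding Un using assms(3) by (intro order_tendstoD(1)) auto
  then obtain k where k: "measure lebesgue U - e < measure lebesgue (A k)"
    by (auto simp: eventually_sequentially)
  show ?thesis
  proof (rule that)
    fix \<rho> :: real assume \<rho>: "0 < \<rho>" "\<rho> \<le> 1 / Suc k"
    have "measure lebesgue (A k) \<le> measure lebesgue (erosion \<rho> U)"
    proof (rule measure_mono_fmeasurable)
      show "A k \<subseteq> erosion \<rho> U"
        using subset_ball[OF \<rho>(2)] by (force simp: A_def erosion_def)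
      show "A k \<in> sets lebesgue"
        using erosion_lmeasurable[OF assms(2), of "1 / Suc k"] by (auto simp: A_def)
    qed (use erosion_lmeasurable[OF assms(2)] \<rho> in auto)
    then show "measure lebesgue U - e < measure lebesgue (erosion \<rho> U)" using k by linarith
  qed simp
qed

text \<open>A cell through a point of the erosion has diameter below \<rho> and so lies entirely in
  \<open>U\<close>. Thus the inner cells fill \<open>U\<close> up to the volume lost by erosion,
  whatever the shape of its boundary.\<close>

lemma measure_erosion_le_cells:
  fixes U :: "(real ^ 'n) set" and h :: real
  assumes "bounded U" "0 < h" "CARD('n) * h < \<rho>"
  shows "measure lebesgue (erosion \<rho> U) \<le> card {z. cell h z \<subseteq> U} * h ^ CARD('n)"
proof -
  let ?Z = "{z. cell h z \<subseteq> U}"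
  have fin: "finite ?Z" by (rule finite_cells_inside[OF assms(1,2)])
  have "erosion \<rho> U \<subseteq> (\<Union>z\<in>?Z. cell h z)"
  proof
    fix x assume x: "x \<in> erosion \<rho> U"
    obtain z where z: "x \<in> cell h z" using cells_cover[OF assms(2)] .
    have "cell h z \<subseteq> ball x \<rho>"
    proof
      fix y assume "y \<in> cell h z"
      then have "dist x y \<le> CARD('n) * h" using dist_cube[OF z[unfolded cell_def]] unfolding cell_def by blast
      then show "y \<in> ball x \<rho>" using assms(3) by simp
    qed
    then show "x \<in> (\<Union>z\<in>?Z. cell h z)" using x z by (auto simp: erosion_def)
  qed
  then have "measure lebesgue (erosion \<rho> U) \<le> measure lebesgue (\<Union>z\<in>?Z. cell h z)"
    using fin by (intro measure_mono_fmeasurable UN_cells_lmeasurable)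
      (simp_all add: borel_closed[OF closed_erosion])
  then show ?thesis using measure_UN_cells[OF fin] assms(2) by simp
qed

section \<open>Congruent copies and packings\<close>

lemma emeasure_lebesgue_congruent_balls:
  fixes a b :: "'a::euclidean_space"
  shows "emeasure lebesgue (ball a r) = emeasure lebesgue (ball b r)"
proof -
  have "ball b r = (\<lambda>x. 1 *\<^sub>R x + (b - a)) ` ball a r"
    using ball_translation[of "b - a" a r] by (simp add: add.commute cong: image_cong_simp)
  then show ?thesis using emeasure_lebesgue_affine[of 1 "b - a" "ball a r"] by simp
qed

text \<open>The library proves invariance of Lebesgue measure under orthogonal maps of \<open>real ^ 'n\<close> only for
  well-ordered index types, by Gaussian elimination. Filling an open set with disjoint balls
  (Vitali) needs no order on the indices.\<close>

lemma emeasure_orthogonal_image_open_ge: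
  fixes f :: "'a::euclidean_space \<Rightarrow> 'a"
  assumes f: "orthogonal_transformation f" and "open U"
  shows "emeasure lebesgue U \<le> emeasure lebesgue (f ` U)"
proof -
  have bij: "bij f" "linear f" using f orthogonal_transformation_bij orthogonal_transformation_linear by auto
  let ?K = "{(x, r). ball x r \<subseteq> U} :: ('a \<times> real) set"
  let ?b = "\<lambda>i :: 'a \<times> real. ball (fst i) (snd i)"
  obtain C where C: "countable C" "C \<subseteq> ?K" "pairwise (\<lambda>i j. disjnt (?b i) (?b j)) C"
    and neg: "negligible (U - (\<Union>i\<in>C. ?b i))"
  proof (rule Vitali_covering_theorem_balls[of U ?K fst snd])
    fix x and d :: real assume "x \<in> U" "0 < d"
    then obtain r where r: "0 < r" "ball x r \<subseteq> U" using \<open>open U\<close> by (meson openE)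
    then have "ball x (min r (d/2)) \<subseteq> U" by auto
    then show "\<exists>i. i \<in> ?K \<and> x \<in> ?b i \<and> snd i < d"
      using r \<open>0 < d\<close> by (intro exI[of _ "(x, min r (d/2))"]) auto
  qed
  \<comment> \<open>Balls go to balls of the same radius: here orthogonality enters beyond linearity
    and bijectivity, and it preserves the countable sum term by term.\<close>
  have im: "f ` ?b i = ball (f (fst i)) (snd i)" for i
    by (simp add: image_orthogonal_transformation_ball f)
  have disj: "disjoint_family_on ?b C"
    using C(3) by (auto simp: disjoint_family_on_def pairwise_def disjnt_def)
  have disj': "disjoint_family_on (\<lambda>i. f ` ?b i) C"
    using disj bij by (auto simp: disjoint_family_on_def image_Int[symmetric] bij_is_inj)
  have balls: "(\<Union>i\<in>C. ?b i) \<in> sets lebesgue"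
    by (rule sets.countable_UN'[OF C(1)]) auto
  have "emeasure lebesgue U \<le> emeasure lebesgue ((\<Union>i\<in>C. ?b i) \<union> (U - (\<Union>i\<in>C. ?b i)))"
  proof (rule emeasure_mono)
    show "(\<Union>i\<in>C. ?b i) \<union> (U - (\<Union>i\<in>C. ?b i)) \<in> sets lebesgue"
      by (intro sets.Un balls negligible_imp_sets[OF neg])
  qed auto
  also have "\<dots> = emeasure lebesgue (\<Union>i\<in>C. ?b i)"
    using neg by (intro emeasure_Un_null_set balls) (simp add: negligible_iff_null_sets)
  also have "\<dots> = (\<integral>\<^sup>+i. emeasure lebesgue (?b i) \<partial>count_space C)"
    by (rule emeasure_UN_countable[OF _ C(1) disj]) simp
  also have "\<dots> = (\<integral>\<^sup>+i. emeasure lebesgue (f ` ?b i) \<partial>count_space C)"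
    unfolding im by (intro nn_integral_cong emeasure_lebesgue_congruent_balls)
  also have "\<dots> = emeasure lebesgue (\<Union>i\<in>C. f ` ?b i)"
    by (rule emeasure_UN_countable[OF _ C(1) disj', symmetric]) (simp add: im)
  also have "\<dots> \<le> emeasure lebesgue (f ` U)"
  proof (rule emeasure_mono)
    have "open (f ` U)" using bij \<open>open U\<close> by (simp add: open_bijective_linear_image_eq)
    then show "f ` U \<in> sets lebesgue" by (simp add: borel_open)
  qed (use C(2) in fastforce)
  finally show ?thesis .
qed

lemma emeasure_orthogonal_image_open:
  fixes f :: "'a::euclidean_space \<Rightarrow> 'a"
  assumes f: "orthogonal_transformation f" and "open U"
  shows "emeasure lebesgue (f ` U) = emeasure lebesgue U"
proof (rule antisym)
  have bij: "bij f" "linear f" using f orthogonal_transformation_bij orthogonal_transformation_linear by auto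
  have "open (f ` U)" using bij \<open>open U\<close> by (simp add: open_bijective_linear_image_eq)
  moreover have "inv f ` f ` U = U" using bij by (simp add: bij_is_inj)
  ultimately show "emeasure lebesgue (f ` U) \<le> emeasure lebesgue U"
    using emeasure_orthogonal_image_open_ge[OF orthogonal_transformation_inv[OF f], of "f ` U"] by simp
qed (rule emeasure_orthogonal_image_open_ge[OF assms])

lemma measure_orthogonal_image_open:
  fixes f :: "'a::euclidean_space \<Rightarrow> 'a"
  assumes "orthogonal_transformation f" "open U"
  shows "measure lebesgue (f ` U) = measure lebesgue U"
  by (simp add: measure_def emeasure_orthogonal_image_open[OF assms])

text \<open>Complementation in a ball about the origin, which the map preserves, reduces the compact
  case to the open one. The compact case serves erosions, the open one interiors of bodies.\<close>

lemma measure_orthogonal_image_compact: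
  fixes f :: "'a::euclidean_space \<Rightarrow> 'a"
  assumes f: "orthogonal_transformation f" and "compact S"
  shows "measure lebesgue (f ` S) = measure lebesgue S"
proof -
  obtain b where b: "S \<subseteq> ball 0 b" using compact_imp_bounded[OF \<open>compact S\<close>] bounded_subset_ballD by blast
  have lin: "linear f" "inj f" using f by (simp_all add: orthogonal_transformation_linear orthogonal_transformation_inj)
  have cS: "compact (f ` S)"
    using assms(2) lin(1) by (simp add: compact_continuous_image linear_continuous_on linear_conv_bounded_linear)
  have ball: "f ` ball 0 b = ball 0 b"
    using image_orthogonal_transformation_ball[OF f, of 0 b] lin(1) by (simp add: linear_0)
  have sub: "f ` S \<subseteq> ball 0 b" using b ball by blast
  have "measure lebesgue (ball 0 b - f ` S) = measure lebesgue (ball 0 b - S)"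
  proof -
    have "f ` (ball 0 b - S) = ball 0 b - f ` S"
      using image_set_diff[OF lin(2), of "ball 0 b" S] ball by simp
    moreover have "open (ball 0 b - S)"
      using assms(2) by (simp add: open_Diff compact_imp_closed)
    ultimately show ?thesis using measure_orthogonal_image_open[OF f] by metis
  qed
  moreover have "measure lebesgue (ball 0 b - f ` S) = measure lebesgue (ball 0 b :: 'a set) - measure lebesgue (f ` S)"
    using sub lmeasurable_compact[OF cS] by (intro measurable_measure_Diff) auto
  moreover have "measure lebesgue (ball 0 b - S) = measure lebesgue (ball 0 b :: 'a set) - measure lebesgue S"
    using b lmeasurable_compact[OF assms(2)] by (intro measurable_measure_Diff) auto
  ultimately show ?thesis by simp
qed

section \<open>Rigid motions\<close>

definition rigid :: "(real ^ 'n \<Rightarrow> real ^ 'n) \<Rightarrow> bool" where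
  "rigid g \<longleftrightarrow> (\<exists>R t. orthogonal_transformation R \<and> g = (\<lambda>x. R x + t))"

lemma congruent_copy_iff_rigid: "congruent_copy K B \<longleftrightarrow> (\<exists>g. rigid g \<and> K = g ` B)"
  by (auto simp: congruent_copy_def rigid_def)

context
  fixes g :: "real ^ 'n \<Rightarrow> real ^ 'n" assumes g: "rigid g"
begin

lemma rigid_decompose:
  obtains R t where "orthogonal_transformation R" "\<And>S. g ` S = (+) t ` (R ` S)"
proof -
  obtain R t where R: "orthogonal_transformation R" "g = (\<lambda>x. R x + t)" using g by (auto simp: rigid_def)
  then have "g ` S = (+) t ` (R ` S)" for S by (simp add: image_image add.commute)
  with R(1) show ?thesis using that by blast
qed

lemma dist_rigid: "dist (g x) (g y) = dist x y"
  using g by (auto simp: rigid_def orthogonal_transformation_isometry)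

lemma bij_rigid: "bij g"
proof -
  obtain R t where R: "orthogonal_transformation R" "g = (\<lambda>x. R x + t)" using g by (auto simp: rigid_def)
  have "g = (\<lambda>x. x + t) \<circ> R" using R(2) by auto
  then show ?thesis using orthogonal_transformation_bij[OF R(1)] by (metis bij_comp bij_plus_right)
qed

lemma interior_rigid_image: "interior (g ` S) = g ` interior S"
proof -
  obtain R t where R: "orthogonal_transformation R" "\<And>S. g ` S = (+) t ` (R ` S)" using rigid_decompose by metis
  show ?thesis unfolding R(2) interior_translation
    using R(1) by (simp add: interior_injective_linear_image orthogonal_transformation_linear orthogonal_transformation_inj)
qed

lemma closure_rigid_image: "closure (g ` S) = g ` closure S"
proof -
  obtain R t where R: "orthogonal_transformation R" "\<And>S. g ` S = (+) t ` (R ` S)" using rigid_decompose by metis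
  show ?thesis unfolding R(2) closure_translation
    using R(1) by (simp add: closure_injective_linear_image orthogonal_transformation_linear orthogonal_transformation_inj)
qed

lemma frontier_rigid_image: "frontier (g ` S) = g ` frontier S"
  using bij_rigid by (simp add: frontier_def interior_rigid_image closure_rigid_image image_set_diff bij_is_inj)

lemma negligible_rigid_image: "negligible S \<Longrightarrow> negligible (g ` S)"
proof -
  assume S: "negligible S"
  obtain R t where R: "orthogonal_transformation R" "\<And>S. g ` S = (+) t ` (R ` S)" using rigid_decompose by metis
  have "R differentiable_on S"
    using R(1) orthogonal_transformation_linear linear_imp_differentiable_on by blast
  then show "negligible (g ` S)" unfolding R(2)
    using negligible_differentiable_image_negligible[OF order_refl S] by (simp add: negligible_translation)
qed

lemma measure_rigid_image_open: "open S \<Longrightarrow> measure lebesgue (g ` S) = measure lebesgue S"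
proof -
  assume S: "open S"
  obtain R t where R: "orthogonal_transformation R" "\<And>S. g ` S = (+) t ` (R ` S)" using rigid_decompose by metis
  then show "measure lebesgue (g ` S) = measure lebesgue S" using S by (simp add: measure_translation measure_orthogonal_image_open)
qed

lemma measure_rigid_image_compact: "compact S \<Longrightarrow> measure lebesgue (g ` S) = measure lebesgue S"
proof -
  assume S: "compact S"
  obtain R t where R: "orthogonal_transformation R" "\<And>S. g ` S = (+) t ` (R ` S)" using rigid_decompose by metis
  then show "measure lebesgue (g ` S) = measure lebesgue S" using S by (simp add: measure_translation measure_orthogonal_image_compact)
qed

text \<open>A bijective isometry carries balls to balls of the same radius. This is why an erosion
  radius chosen for a body serves all its congruent copies.\<close>

lemma erosion_rigid_image: "erosion \<rho> (g ` S) = g ` erosion \<rho> S"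
proof -
  have surj: "\<exists>x. y = g x" for y using bij_rigid by (metis bij_pointE)
  have inj: "g x \<in> g ` S \<longleftrightarrow> x \<in> S" for x S using bij_rigid by (simp add: bij_is_inj inj_image_mem_iff)
  have "g x \<in> erosion \<rho> (g ` S) \<longleftrightarrow> x \<in> erosion \<rho> S" for x
  proof -
    have "g x \<in> erosion \<rho> (g ` S) \<longleftrightarrow> (\<forall>y. dist (g x) y < \<rho> \<longrightarrow> y \<in> g ` S)"
      by (auto simp: erosion_def)
    also have "\<dots> \<longleftrightarrow> (\<forall>y. dist (g x) (g y) < \<rho> \<longrightarrow> g y \<in> g ` S)"
      using surj by metis
    also have "\<dots> \<longleftrightarrow> x \<in> erosion \<rho> S" by (auto simp: dist_rigid inj erosion_def)
    finally show ?thesis .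
  qed
  then show ?thesis using surj inj by (auto simp: set_eq_iff) (metis imageI)+
qed

end

section \<open>Bodies\<close>

lemma body_lmeasurable: "body B \<Longrightarrow> B \<in> lmeasurable"
  by (simp add: body_def measurable_Jordan negligible_iff_null_sets)

lemma body_bounded: "body B \<Longrightarrow> bounded B"
  by (simp add: body_def)

lemma body_negligible_frontier: "body B \<Longrightarrow> negligible (frontier B)"
  by (simp add: body_def negligible_iff_null_sets)

lemma body_measure_interior: "body B \<Longrightarrow> measure lebesgue (interior B) = measure lebesgue B"
  by (rule measure_interior[OF body_bounded body_negligible_frontier])

lemma body_measure_closure: "body B \<Longrightarrow> measure lebesgue (closure B) = measure lebesgue B"
  by (rule measure_closure[OF body_bounded body_negligible_frontier])

lemma body_measure_pos: "body B \<Longrightarrow> 0 < measure lebesgue B"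
proof -
  assume B: "body B"
  then obtain x e where xe: "0 < e" "ball x e \<subseteq> interior B"
    unfolding body_def by (metis all_not_in_conv open_contains_ball open_interior)
  have "0 < measure lebesgue (ball x e)" using xe(1) by (simp add: content_ball_pos)
  also have "\<dots> \<le> measure lebesgue B"
    using xe(2) interior_subset[of B] body_lmeasurable[OF B] by (intro measure_mono_fmeasurable) auto
  finally show "0 < measure lebesgue B" .
qed

lemma body_rigid_image: "body B \<Longrightarrow> rigid g \<Longrightarrow> body (g ` B)"
proof -
  assume B: "body B" and g: "rigid g"
  obtain R t where R: "orthogonal_transformation R" "\<And>S. g ` S = (+) t ` (R ` S)" using rigid_decompose[OF g] by metis
  have "bounded (g ` B)"
    unfolding R(2) using R(1) B
    by (simp add: bounded_translation bounded_linear_image body_def orthogonal_transformation_linear linear_conv_bounded_linear[symmetric])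
  then show "body (g ` B)"
    using B g by (simp add: body_def interior_rigid_image frontier_rigid_image negligible_rigid_image flip: negligible_iff_null_sets)
qed

text \<open>The detour through the interior reduces a general body to an open set; both the body and
  its image have the measure of their interiors because their frontiers are null.\<close>

lemma measure_rigid_image_body: "body B \<Longrightarrow> rigid g \<Longrightarrow> measure lebesgue (g ` B) = measure lebesgue B"
  using body_measure_interior[OF body_rigid_image[of B g]] body_measure_interior[of B]
  by (simp add: interior_rigid_image measure_rigid_image_open)

lemma measure_erosion_rigid_image:
  assumes "bounded S" "0 < \<rho>" "rigid g"
  shows "measure lebesgue (erosion \<rho> (g ` S)) = measure lebesgue (erosion \<rho> S)"
proof -
  have "compact (erosion \<rho> S)"
    using bounded_subset[OF assms(1) erosion_subset[OF assms(2)]] closed_erosion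
    by (simp add: compact_eq_bounded_closed)
  then show ?thesis by (simp add: erosion_rigid_image measure_rigid_image_compact assms)
qed

section \<open>Packings\<close>

lemma packingsI:
  assumes "\<And>K. K \<in> P \<Longrightarrow> \<exists>A\<in>D. congruent_copy K A"
    and "\<And>K L. K \<in> P \<Longrightarrow> L \<in> P \<Longrightarrow> K \<noteq> L \<Longrightarrow> interior K \<inter> interior L = {}"
  shows "P \<in> packings D"
  using assms by (simp add: packings_def)

lemma packing_congruent: "P \<in> packings D \<Longrightarrow> K \<in> P \<Longrightarrow> \<exists>A\<in>D. congruent_copy K A"
  by (simp add: packings_def)

lemma packing_interior_disjoint:
  "P \<in> packings D \<Longrightarrow> K \<in> P \<Longrightarrow> L \<in> P \<Longrightarrow> K \<noteq> L \<Longrightarrow> interior K \<inter> interior L = {}"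
  by (simp add: packings_def)

lemma packings_subset: "P \<in> packings D \<Longrightarrow> Q \<subseteq> P \<Longrightarrow> Q \<in> packings D"
  by (rule packingsI) (auto dest: packing_congruent packing_interior_disjoint)

lemma packings_mono: "P \<in> packings D \<Longrightarrow> D \<subseteq> E \<Longrightarrow> P \<in> packings E"
  by (rule packingsI) (use packing_congruent packing_interior_disjoint in fast)+

lemma packings_Un:
  assumes "P \<in> packings D" "Q \<in> packings D"
    and "\<And>K L. K \<in> P \<Longrightarrow> L \<in> Q \<Longrightarrow> interior K \<inter> interior L = {}"
  shows "P \<union> Q \<in> packings D"
proof -
  have "interior L \<inter> interior K = {}" if "K \<in> P" "L \<in> Q" for K L
    using assms(3)[OF that] by (simp add: Int_commute)
  with assms show ?thesis by (simp add: packings_def ball_Un)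
qed

lemma packing_member:
  assumes "P \<in> packings D" "K \<in> P"
  obtains A g where "A \<in> D" "rigid g" "K = g ` A"
proof -
  have "\<exists>A\<in>D. \<exists>g. rigid g \<and> K = g ` A"
    using assms by (simp add: packings_def congruent_copy_iff_rigid)
  then show ?thesis using that by auto
qed

lemma packing_body:
  assumes "P \<in> packings D" "\<And>A. A \<in> D \<Longrightarrow> body A" "K \<in> P"
  shows "body K"
proof -
  obtain A g where "A \<in> D" "rigid g" "K = g ` A" by (rule packing_member[OF assms(1,3)])
  then show ?thesis using assms(2) body_rigid_image by blast
qed

context
  fixes D :: "(real ^ 'n) set set" and P
  assumes bodies: "\<And>A. A \<in> D \<Longrightarrow> body A" and P: "P \<in> packings D"
begin

lemma packing_lmeasurable: "finite P \<Longrightarrow> \<Union>P \<in> lmeasurable"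
  by (intro fmeasurable.finite_Union) (auto intro: body_lmeasurable packing_body[OF P bodies])

text \<open>Only interiors are disjoint, but two members then meet inside the union of their
  frontiers, which is null.\<close>

lemma measure_packing:
  assumes "finite P" shows "measure lebesgue (\<Union>P) = (\<Sum>K\<in>P. measure lebesgue K)"
proof (rule measure_negligible_finite_Union[OF assms])
  show "pairwise (\<lambda>S T. negligible (S \<inter> T)) P"
    by (intro pairwiseI negligible_Int_if_interiors_disjoint body_negligible_frontier
        packing_interior_disjoint[OF P] packing_body[OF P bodies])
qed (auto intro: body_lmeasurable packing_body[OF P bodies])

end

text \<open>Finitely many shapes have a least volume \<open>m > 0\<close>, inherited by all copies,
  so the volume of \<open>S\<close> limits their number.\<close>

lemma packing_finite:
  fixes D :: "(real ^ 'n) set set"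
  assumes bodies: "\<And>A. A \<in> D \<Longrightarrow> body A" and P: "P \<in> packings D"
    and "finite D" "S \<in> lmeasurable" "\<And>K. K \<in> P \<Longrightarrow> K \<subseteq> S"
  shows "finite P"
proof (rule ccontr)
  assume inf: "infinite P"
  then have "P \<noteq> {}" by auto
  then have "D \<noteq> {}" using packing_congruent[OF P] by auto
  define m where "m = Min (measure lebesgue ` D)"
  have m: "0 < m" unfolding m_def using assms(3) \<open>D \<noteq> {}\<close> body_measure_pos bodies by auto
  have mK: "m \<le> measure lebesgue K" if K: "K \<in> P" for K
  proof -
    obtain A g where A: "A \<in> D" "rigid g" "K = g ` A" by (rule packing_member[OF P K])
    then have "measure lebesgue K = measure lebesgue A" using bodies measure_rigid_image_body by blast
    then show ?thesis unfolding m_def using A(1) assms(3) by simp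
  qed
  obtain N :: nat where N: "measure lebesgue S < N * m" using m by (metis reals_Archimedean3)
  obtain F where F: "F \<subseteq> P" "finite F" "card F = N" using infinite_arbitrarily_large[OF inf] by blast
  have FP: "F \<in> packings D" using P F(1) by (rule packings_subset)
  have "N * m \<le> (\<Sum>K\<in>F. measure lebesgue K)"
    using sum_bounded_below[of F m "measure lebesgue"] mK F by auto
  also have "\<dots> = measure lebesgue (\<Union>F)"
    by (rule measure_packing[OF bodies FP F(2), symmetric])
  also have "\<dots> \<le> measure lebesgue S"
    using packing_lmeasurable[OF bodies FP F(2)] assms(4,5) F(1)
    by (intro measure_mono_fmeasurable) auto
  finally show False using N by simp
qed

lemma affine_image_eq: "(\<lambda>x. a *\<^sub>R x + v) ` K = (+) v ` (\<lambda>x. a *\<^sub>R x) ` K" for K :: "'a::real_vector set"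
  by (simp add: image_image add.commute)

lemma interior_affine_image:
  fixes K :: "(real ^ 'n) set"
  assumes "0 < a"
  shows "interior ((\<lambda>x. a *\<^sub>R x + v) ` K) = (\<lambda>x. a *\<^sub>R x + v) ` interior K"
proof -
  have "interior ((\<lambda>x. a *\<^sub>R x) ` K) = (\<lambda>x. a *\<^sub>R x) ` interior K"
    using assms by (intro interior_injective_linear_image) (auto simp: inj_on_def)
  then show ?thesis by (simp add: affine_image_eq interior_translation)
qed

lemma packings_affine_image:
  fixes D :: "(real ^ 'n) set set"
  assumes "P \<in> packings D" "0 < a"
  shows "(\<lambda>K. (\<lambda>x. a *\<^sub>R x + v) ` K) ` P \<in> packings (dilate a ` D)"
proof -
  let ?g = "\<lambda>x :: real ^ 'n. a *\<^sub>R x + v"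
  have inj: "inj ?g" using assms(2) by (auto simp: inj_on_def)
  have "\<exists>A'\<in>dilate a ` D. congruent_copy (?g ` K) A'" if K: "K \<in> P" for K
  proof -
    obtain A where A: "A \<in> D" "congruent_copy K A" using packing_congruent[OF assms(1) K] by auto
    then obtain R t where R: "orthogonal_transformation R" "K = (\<lambda>x. R x + t) ` A"
      by (auto simp: congruent_copy_def)
    \<comment> \<open>Linearity of \<open>R\<close> gives
      \<open>a (R x + t) + v = R (a x) + (a t + v)\<close>: the scaled copy has the same orthogonal
      part.\<close>
    have "?g ` K = (\<lambda>x. R x + (a *\<^sub>R t + v)) ` dilate a A"
      unfolding R(2) dilate_def image_image
      by (intro image_cong) (simp_all add: orthogonal_transformation_scaleR[OF R(1)] scaleR_add_right add.assoc)
    then show ?thesis using A(1) R(1) unfolding congruent_copy_def by blast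
  qed
  moreover have "interior (?g ` K) \<inter> interior (?g ` L) = {}" if "K \<in> P" "L \<in> P" "?g ` K \<noteq> ?g ` L" for K L
  proof -
    have "interior K \<inter> interior L = {}" using that(3) by (intro packing_interior_disjoint[OF assms(1) that(1,2)]) auto
    then show ?thesis unfolding interior_affine_image[OF assms(2)] image_Int[OF inj, symmetric] by simp
  qed
  ultimately show ?thesis by (intro packingsI) (elim imageE, simp)+
qed

section \<open>Periodized packings\<close>

text \<open>\<open>Z = UNIV\<close> gives the full periodic packing; a finite \<open>Z\<close> gives
  its part in a cube, or a filling of selected cells.\<close>

definition tile :: "real \<Rightarrow> (real ^ 'n) set set \<Rightarrow> (int ^ 'n) set \<Rightarrow> (real ^ 'n) set set" where
  "tile h P Z = (\<Union>z\<in>Z. (\<lambda>K. (+) (lattice_point h z) ` K) ` P)"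

lemma Union_tile: "\<Union>(tile h P Z) = (\<Union>z\<in>Z. (+) (lattice_point h z) ` \<Union>P)"
  unfolding tile_def by blast

lemma tile_member_subset_cell:
  assumes "\<And>K. K \<in> P \<Longrightarrow> K \<subseteq> cube 0 h" "L \<in> tile h P Z"
  obtains z where "z \<in> Z" "L \<subseteq> cell h z"
proof -
  obtain z K where "z \<in> Z" "K \<in> P" "L = (+) (lattice_point h z) ` K" using assms(2) by (auto simp: tile_def)
  then show ?thesis using that[of z] assms(1)[of K] unfolding cell_translate by auto
qed

lemma congruent_copy_translate: "congruent_copy K A \<Longrightarrow> congruent_copy ((+) t ` K) A"
proof -
  assume "congruent_copy K A"
  then obtain R u where R: "orthogonal_transformation R" "K = (\<lambda>x. R x + u) ` A"
    by (auto simp: congruent_copy_def)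
  then have "(+) t ` K = (\<lambda>x. R x + (t + u)) ` A" by (simp add: image_image algebra_simps)
  then show ?thesis using R(1) unfolding congruent_copy_def by blast
qed

lemma tile_packing:
  assumes P: "P \<in> packings D" and sub: "\<And>K. K \<in> P \<Longrightarrow> K \<subseteq> cube 0 h"
  shows "tile h P Z \<in> packings D"
proof -
  have "\<exists>A\<in>D. congruent_copy L A" if "L \<in> tile h P Z" for L
    using that packing_congruent[OF P] congruent_copy_translate unfolding tile_def by fast
  moreover have "interior L \<inter> interior L' = {}" if L: "L \<in> tile h P Z" "L' \<in> tile h P Z" "L \<noteq> L'" for L L'
  proof -
    obtain z K where z: "z \<in> Z" "K \<in> P" "L = (+) (lattice_point h z) ` K" using L(1) by (auto simp: tile_def)
    obtain w K' where w: "w \<in> Z" "K' \<in> P" "L' = (+) (lattice_point h w) ` K'" using L(2) by (auto simp: tile_def)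
    show ?thesis
    proof (cases "z = w")
      case True
      then have "interior K \<inter> interior K' = {}" using z(3) w(3) L(3) by (intro packing_interior_disjoint[OF P z(2) w(2)]) auto
      then show ?thesis using z(3) w(3) True by (auto simp: interior_translation)
    next
      case False
      have "L \<subseteq> cell h z" "L' \<subseteq> cell h w"
        using z w sub[of K] sub[of K'] unfolding cell_translate by auto
      then show ?thesis using interior_cells_disjoint[OF False, of h] interior_mono by blast
    qed
  qed
  ultimately show ?thesis by (rule packingsI)
qed

lemma measure_tile:
  assumes "finite Z" "\<Union>P \<in> lmeasurable" "\<And>K. K \<in> P \<Longrightarrow> K \<subseteq> cube 0 h"
  shows "measure lebesgue (\<Union>(tile h P Z)) = card Z * measure lebesgue (\<Union>P)"
  unfolding Union_tile using assms by (intro measure_UN_translates) auto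

lemma cube_count:
  fixes h :: real
  assumes "0 < h" "4 * CARD('n) * h \<le> r"
  shows "(r - 4 * CARD('n) * h) ^ CARD('n) \<le> card {z :: int ^ 'n. cell h z \<subseteq> cube 0 r} * h ^ CARD('n)"
proof -
  \<comment> \<open>Twice the diameter bound \<open>n h\<close>, because the comparison of cells
    with erosions needs a strict inequality. The side lost is then \<open>2 * \<rho>\<close>, that
    is \<open>4 n h\<close>.\<close>
  define \<rho> where "\<rho> = 2 * CARD('n) * h"
  have \<rho>: "CARD('n) * h < \<rho>" "0 < \<rho>" unfolding \<rho>_def using assms(1) by auto
  have "(r - 2 * \<rho>) ^ CARD('n) = measure lebesgue (cube 0 (r - 2 * \<rho>) :: (real ^ 'n) set)"
    using assms(2) by (simp add: measure_cube \<rho>_def)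
  also have "\<dots> \<le> measure lebesgue (erosion \<rho> (cube 0 r :: (real ^ 'n) set))"
  proof (rule measure_mono_fmeasurable)
    show "cube 0 (r - 2 * \<rho>) \<subseteq> erosion \<rho> (cube 0 r :: (real ^ 'n) set)"
      using cube_near_dist[of _ "0 :: real ^ 'n" "r - 2 * \<rho>" _ \<rho>] by (auto simp: erosion_def)
  qed (auto intro!: erosion_lmeasurable \<rho>(2) simp: fmeasurableD)
  also have "\<dots> \<le> card {z :: int ^ 'n. cell h z \<subseteq> cube 0 r} * h ^ CARD('n)"
    by (rule measure_erosion_le_cells[OF _ assms(1) \<rho>(1)]) simp
  finally show ?thesis by (simp add: \<rho>_def mult.assoc)
qed

section \<open>Optimal density through finite packings\<close>

lemma dilate_one [simp]: "dilate 1 S = S"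
  by (simp add: dilate_def)

lemma packings_translate: "P \<in> packings D \<Longrightarrow> (\<lambda>K. (+) v ` K) ` P \<in> packings D"
proof -
  assume P: "P \<in> packings D"
  have "(\<lambda>K. (\<lambda>x. 1 *\<^sub>R x + v) ` K) = (\<lambda>K :: (real ^ 'a) set. (+) v ` K)"
    by (intro ext image_cong) auto
  moreover have "dilate 1 ` D = D" by (simp add: image_def)
  ultimately show ?thesis using packings_affine_image[OF P, of 1 v] by simp
qed

text \<open>Enlarging or shrinking a cube of side \<open>r\<close> by a fixed amount does not affect
  limiting densities; this absorbs all boundary layers.\<close>

lemma tendsto_shifted_ratio_power:
  "((\<lambda>r::real. X * ((r + k) / r) ^ n) \<longlongrightarrow> X) at_top"
proof -
  have "((\<lambda>r::real. 1 + k * inverse r) \<longlongrightarrow> 1 + k * 0) at_top"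
    by (intro tendsto_intros tendsto_inverse_0_at_top filterlim_ident)
  moreover have "\<forall>\<^sub>F r in at_top. 1 + k * inverse r = (r + k) / r"
    using eventually_gt_at_top[of 0] by eventually_elim (simp add: field_simps)
  ultimately have "((\<lambda>r::real. (r + k) / r) \<longlongrightarrow> 1) at_top"
    using tendsto_cong[of "\<lambda>r. 1 + k * inverse r" "\<lambda>r. (r + k) / r" at_top 1] by simp
  then have "((\<lambda>r::real. X * ((r + k) / r) ^ n) \<longlongrightarrow> X * 1 ^ n) at_top"
    by (intro tendsto_intros)
  then show ?thesis by simp
qed

text \<open>A cube of side \<open>r\<close> contains all cells of side \<open>s\<close> except for a
  boundary layer of thickness proportional to \<open>s\<close>, which vanishes in the limit over
  \<open>r\<close>. Hence no error in \<open>s\<close> remains.\<close>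

lemma packing_density_ge_centered:
  fixes D :: "(real ^ 'n) set set"
  assumes bodies: "\<And>A. A \<in> D \<Longrightarrow> body A" and P: "P \<in> packings D" and fin: "finite P"
    and s: "0 < s" and sub: "\<And>K. K \<in> P \<Longrightarrow> K \<subseteq> cube 0 s"
  shows "ereal (measure lebesgue (\<Union>P) / s ^ CARD('n)) \<le> packing_density D"
proof -
  let ?T = "tile s P UNIV" and ?n = "CARD('n)"
  let ?X = "measure lebesgue (\<Union>P) / s ^ ?n"
  \<comment> \<open>The loss of side length in \<open>cube_count\<close>.\<close>
  define k where "k = 4 * ?n * s"
  have meas: "\<Union>P \<in> lmeasurable" by (rule packing_lmeasurable[OF bodies P fin])
  have T: "?T \<in> packings D" by (rule tile_packing[OF P sub])
  have Tm: "\<Union>?T \<in> sets lebesgue"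
    unfolding Union_tile
    by (intro sets.countable_UN' image_subsetI fmeasurableD measurable_translation meas) simp
  have "?X * ((r + - k) / r) ^ ?n \<le> measure lebesgue (\<Union>?T \<inter> dilate r unit_cube) / r ^ ?n"
    if r: "r \<ge> k" for r
  proof -
    let ?Z = "{z :: int ^ 'n. cell s z \<subseteq> cube 0 r}"
    have "0 < k" unfolding k_def using s by simp
    then have r0: "0 < r" using r by linarith
    have finZ: "finite ?Z" by (rule finite_cells_inside) (simp_all add: s)
    have "(r - k) ^ ?n \<le> card ?Z * s ^ ?n"
      using cube_count[OF s, where r = r and 'n = 'n] r by (simp add: k_def)
    then have "(r - k) ^ ?n * measure lebesgue (\<Union>P) \<le> card ?Z * s ^ ?n * measure lebesgue (\<Union>P)"
      by (rule mult_right_mono) simp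
    then have "?X * (r - k) ^ ?n \<le> card ?Z * measure lebesgue (\<Union>P)"
      using s by (simp add: field_simps)
    also have "\<dots> = measure lebesgue (\<Union>(tile s P ?Z))"
      by (rule measure_tile[OF finZ meas sub, symmetric])
    also have "\<dots> \<le> measure lebesgue (\<Union>?T \<inter> cube 0 r)"
    proof (rule measure_mono_fmeasurable)
      show "\<Union>(tile s P ?Z) \<subseteq> \<Union>?T \<inter> cube 0 r"
      proof (intro Int_greatest Union_least)
        fix L assume "L \<in> tile s P ?Z"
        then obtain z where "z \<in> ?Z" "L \<subseteq> cell s z" using tile_member_subset_cell[OF sub] by metis
        then show "L \<subseteq> cube 0 r" by auto
      next
        fix L assume "L \<in> tile s P ?Z"
        then show "L \<subseteq> \<Union>?T" by (auto simp: tile_def)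
      qed
      show "\<Union>(tile s P ?Z) \<in> sets lebesgue"
        unfolding Union_tile
        by (intro sets.finite_UN finZ fmeasurableD measurable_translation meas)
      show "\<Union>?T \<inter> cube 0 r \<in> lmeasurable"
        using fmeasurable_Int_fmeasurable[OF cube_lmeasurable Tm] by (simp add: Int_commute)
    qed
    finally have "?X * (r - k) ^ ?n \<le> measure lebesgue (\<Union>?T \<inter> dilate r unit_cube)"
      using r0 by (simp add: dilate_unit_cube)
    then have "?X * (r - k) ^ ?n / r ^ ?n \<le> measure lebesgue (\<Union>?T \<inter> dilate r unit_cube) / r ^ ?n"
      using r0 by (intro divide_right_mono) auto
    then show ?thesis by (simp only: power_divide times_divide_eq_right diff_conv_add_uminus)
  qed
  then have ev: "\<forall>\<^sub>F r in at_top. ereal (?X * ((r + - k) / r) ^ ?n)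
      \<le> ereal (measure lebesgue (\<Union>?T \<inter> dilate r unit_cube) / r ^ ?n)"
    by (auto simp: eventually_at_top_linorder)
  have "Limsup at_top (\<lambda>r. ereal (?X * ((r + - k) / r) ^ ?n)) = ereal ?X"
    by (intro lim_imp_Limsup tendsto_ereal tendsto_shifted_ratio_power) simp
  then have "ereal ?X \<le> upper_density (\<Union>?T)"
    unfolding upper_density_def using Limsup_mono[OF ev] by simp
  also have "\<dots> \<le> packing_density D"
    unfolding packing_density_def using T by (rule SUP_upper)
  finally show ?thesis .
qed

lemma packing_density_ge:
  fixes D :: "(real ^ 'n) set set"
  assumes bodies: "\<And>A. A \<in> D \<Longrightarrow> body A" and P: "P \<in> packings D" and fin: "finite P"
    and s: "0 < s" and sub: "\<And>K. K \<in> P \<Longrightarrow> K \<subseteq> cube c s"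
  shows "ereal (measure lebesgue (\<Union>P) / s ^ CARD('n)) \<le> packing_density D"
proof -
  let ?Q = "(\<lambda>K. (+) (- c) ` K) ` P"
  have c: "(+) (- c) ` cube c s = cube 0 s"
    using cube_affine_image[of 1 "- c" c s] by (simp add: add.commute cong: image_cong_simp)
  have "ereal (measure lebesgue (\<Union>?Q) / s ^ CARD('n)) \<le> packing_density D"
  proof (rule packing_density_ge_centered[OF bodies packings_translate[OF P] _ s])
    fix K assume "K \<in> ?Q"
    then obtain L where L: "L \<in> P" "K = (+) (- c) ` L" by auto
    show "K \<subseteq> cube 0 s" unfolding L(2) c[symmetric] by (intro image_mono sub L(1))
  qed (use fin in auto)
  moreover have "\<Union>?Q = (+) (- c) ` \<Union>P" by (simp add: image_Union)
  ultimately show ?thesis by (simp only: measure_translation)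
qed

lemma copies_uniformly_bounded:
  fixes D :: "(real ^ 'n) set set"
  assumes "finite D" and bodies: "\<And>A. A \<in> D \<Longrightarrow> body A"
  obtains d where "0 \<le> d"
    "\<And>P K x y. P \<in> packings D \<Longrightarrow> K \<in> P \<Longrightarrow> x \<in> K \<Longrightarrow> y \<in> K \<Longrightarrow> dist x y \<le> d"
proof -
  \<comment> \<open>The diameter of the union of all shapes is one bound for every single shape, and
    it also covers empty \<open>D\<close>.\<close>
  have bd: "bounded (\<Union>D)" using assms body_bounded by (intro bounded_Union) auto
  show ?thesis
  proof
    show "0 \<le> diameter (\<Union>D)" using bd by (rule diameter_ge_0)
    fix P K and x y :: "real ^ 'n" assume PK: "P \<in> packings D" "K \<in> P" and xy: "x \<in> K" "y \<in> K"
    obtain A g where A: "A \<in> D" "rigid g" "K = g ` A" by (rule packing_member[OF PK])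
    obtain a b where "a \<in> A" "b \<in> A" "x = g a" "y = g b" using xy A(3) by auto
    then show "dist x y \<le> diameter (\<Union>D)"
      using A(1) dist_rigid[OF A(2)] diameter_bounded_bound[OF bd, of a b] by auto
  qed
qed

text \<open>The slack \<open>c\<close> is fixed before \<open>P\<close> and \<open>t\<close>, so it
  disappears in the limit just like the margin \<open>2 * d\<close> needed to contain the copies
  that meet the cube. This allows estimates in a slightly enlarged cube.\<close>

lemma packing_density_le:
  fixes D :: "(real ^ 'n) set set"
  assumes "finite D" and bodies: "\<And>A. A \<in> D \<Longrightarrow> body A"
    and bound: "\<And>P t. P \<in> packings D \<Longrightarrow> finite P \<Longrightarrow> 0 < t \<Longrightarrow> (\<And>K. K \<in> P \<Longrightarrow> K \<subseteq> cube 0 t)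
      \<Longrightarrow> measure lebesgue (\<Union>P) \<le> X * (t + c) ^ CARD('n)"
  shows "packing_density D \<le> ereal X"
  unfolding packing_density_def
proof (rule SUP_least)
  fix P assume P: "P \<in> packings D"
  obtain d where d: "0 \<le> d"
    "\<And>P K x y. P \<in> packings D \<Longrightarrow> K \<in> P \<Longrightarrow> x \<in> K \<Longrightarrow> y \<in> K \<Longrightarrow> dist x y \<le> d"
    using copies_uniformly_bounded[OF assms(1) bodies] by metis
  have "measure lebesgue (\<Union>P \<inter> dilate r unit_cube) / r ^ CARD('n) \<le> X * ((r + (2 * d + c)) / r) ^ CARD('n)"
    if r: "1 \<le> r" for r
  proof -
    define Q where "Q = {K \<in> P. K \<inter> cube 0 r \<noteq> {}}"
    have Q: "Q \<in> packings D" using packings_subset[OF P] by (simp add: Q_def)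
    have sub: "K \<subseteq> cube 0 (r + 2 * d)" if K: "K \<in> Q" for K
    proof
      fix y assume y: "y \<in> K"
      obtain x where x: "x \<in> K" "x \<in> cube 0 r" using K unfolding Q_def by blast
      then show "y \<in> cube 0 (r + 2 * d)" using d(2)[OF Q K x(1) y] by (intro cube_near_dist)
    qed
    have fin: "finite Q" by (rule packing_finite[OF bodies Q assms(1) cube_lmeasurable sub])
    have Qm: "\<Union>Q \<in> lmeasurable" by (rule packing_lmeasurable[OF bodies Q fin])
    have eq: "\<Union>P \<inter> dilate r unit_cube = \<Union>Q \<inter> cube 0 r"
      using r by (auto simp: dilate_unit_cube Q_def)
    have "measure lebesgue (\<Union>P \<inter> dilate r unit_cube) \<le> measure lebesgue (\<Union>Q)"
      unfolding eq using Qm by (intro measure_mono_fmeasurable sets.Int) (auto simp: fmeasurableD)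
    also have "\<dots> \<le> X * (r + 2 * d + c) ^ CARD('n)"
      using r d(1) by (intro bound[OF Q fin _ sub]) auto
    finally have "measure lebesgue (\<Union>P \<inter> dilate r unit_cube) / r ^ CARD('n)
        \<le> X * (r + 2 * d + c) ^ CARD('n) / r ^ CARD('n)"
      using r by (intro divide_right_mono) auto
    then show ?thesis by (simp only: power_divide times_divide_eq_right add.assoc)
  qed
  then have ev: "\<forall>\<^sub>F r in at_top. ereal (measure lebesgue (\<Union>P \<inter> dilate r unit_cube) / r ^ CARD('n))
      \<le> ereal (X * ((r + (2 * d + c)) / r) ^ CARD('n))"
    by (auto simp: eventually_at_top_linorder)
  have "Limsup at_top (\<lambda>r. ereal (X * ((r + (2 * d + c)) / r) ^ CARD('n))) = ereal X"
    by (intro lim_imp_Limsup tendsto_ereal tendsto_shifted_ratio_power) simp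
  then show "upper_density (\<Union>P) \<le> ereal X"
    unfolding upper_density_def using Limsup_mono[OF ev] by simp
qed

text \<open>Finiteness moves the later algebra from extended reals to reals; the bounds 0 and 1
  supply the signs for the monotonicity arguments.\<close>

lemma packing_density_real:
  fixes D :: "(real ^ 'n) set set"
  assumes "finite D" and bodies: "\<And>A. A \<in> D \<Longrightarrow> body A"
  obtains \<delta> where "packing_density D = ereal \<delta>" "0 \<le> \<delta>" "\<delta> \<le> 1"
proof -
  have le: "packing_density D \<le> ereal 1"
  proof (rule packing_density_le[OF assms, where c = 0])
    fix P t assume P: "P \<in> packings D" "finite P" "0 < t" "\<And>K. K \<in> P \<Longrightarrow> K \<subseteq> cube 0 t"
    have "measure lebesgue (\<Union>P) \<le> measure lebesgue (cube 0 t :: (real ^ 'n) set)"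
      using packing_lmeasurable[OF bodies P(1,2)] P(4) by (intro measure_mono_fmeasurable) auto
    then show "measure lebesgue (\<Union>P) \<le> 1 * (t + 0) ^ CARD('n)" using P(3) by (simp add: measure_cube)
  qed
  have "{} \<in> packings D" by (simp add: packings_def)
  from packing_density_ge_centered[OF bodies this, of 1] have "0 \<le> packing_density D"
    by (simp add: zero_ereal_def)
  with le show ?thesis using that by (cases "packing_density D") auto
qed

text \<open>If all finite packings in cubes fell short by \<open>e\<close>, then
  \<open>packing_density_le\<close> with \<open>c = 0\<close> would push the optimal density below
  \<delta>. There is no control over the side \<open>s\<close>.\<close>

lemma dense_packing_exists:
  fixes D :: "(real ^ 'n) set set"
  assumes "finite D" and bodies: "\<And>A. A \<in> D \<Longrightarrow> body A"
    and "packing_density D = ereal \<delta>" "0 < e"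
  obtains P s where "P \<in> packings D" "finite P" "0 < s" "\<And>K. K \<in> P \<Longrightarrow> K \<subseteq> cube 0 s"
    "(\<delta> - e) * s ^ CARD('n) < measure lebesgue (\<Union>P)"
proof (rule ccontr)
  assume no: "\<not> thesis"
  have "packing_density D \<le> ereal (\<delta> - e)"
  proof (rule packing_density_le[OF assms(1) bodies, where c = 0])
    fix P t assume "P \<in> packings D" "finite P" "0 < t" "\<And>K. K \<in> P \<Longrightarrow> K \<subseteq> cube 0 t"
    then show "measure lebesgue (\<Union>P) \<le> (\<delta> - e) * (t + 0) ^ CARD('n)"
      using no that[of P t] by force
  qed
  with assms(3,4) show False by simp
qed

text \<open>Scaling by \<open>1 / r\<close> changes the packing and the cube by the same volume
  factor. The resulting bound holds for all \<open>r\<close> and \<open>s\<close>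
  independently.\<close>

lemma measure_packing_dilate_le:
  fixes B :: "(real ^ 'n) set"
  assumes B: "body B" and \<delta>: "packing_density {B} = ereal \<delta>" and r: "0 < r"
    and Q: "Q \<in> packings {dilate r B}" "finite Q" and s: "0 < s" and sub: "\<And>K. K \<in> Q \<Longrightarrow> K \<subseteq> cube c s"
  shows "measure lebesgue (\<Union>Q) \<le> \<delta> * s ^ CARD('n)"
proof -
  let ?g = "\<lambda>x :: real ^ 'n. (1 / r) *\<^sub>R x + 0"
  let ?Q = "(\<lambda>K. ?g ` K) ` Q"
  have "dilate (1 / r) ` {dilate r B} = {B}" using r by (simp add: dilate_def image_image)
  then have Q': "?Q \<in> packings {B}" using packings_affine_image[OF Q(1), of "1 / r" 0] r by simp
  have "ereal (measure lebesgue (\<Union>?Q) / (1 / r * s) ^ CARD('n)) \<le> packing_density {B}"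
  proof (rule packing_density_ge[OF _ Q'])
    fix K assume "K \<in> ?Q"
    then obtain L where L: "L \<in> Q" "K = ?g ` L" by auto
    have "?g ` L \<subseteq> ?g ` cube c s" by (intro image_mono sub L(1))
    then show "K \<subseteq> cube ((1 / r) *\<^sub>R c + 0) (1 / r * s)"
      unfolding L(2) using r by (subst (asm) cube_affine_image) simp_all
  qed (use B Q(2) r s in auto)
  moreover have "\<Union>?Q = ?g ` \<Union>Q" by (simp add: image_Union)
  moreover have "measure lebesgue (?g ` \<Union>Q) = \<bar>1 / r\<bar> ^ CARD('n) * measure lebesgue (\<Union>Q)"
    using measure_lebesgue_affine[of "1 / r" "0 :: real ^ 'n" "\<Union>Q"] by simp
  ultimately have "(1 / r) ^ CARD('n) * measure lebesgue (\<Union>Q) / (1 / r * s) ^ CARD('n) \<le> \<delta>"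
    using \<delta> r by simp
  then show ?thesis using r s by (simp add: power_mult_distrib field_simps)
qed

lemma body_dilate: "body B \<Longrightarrow> 0 < r \<Longrightarrow> body (dilate r B)"
proof -
  assume B: "body B" and r: "0 < r"
  have int: "interior (dilate r B) = dilate r (interior B)"
    using interior_affine_image[OF r, of 0 B] by (simp add: dilate_def)
  moreover have "closure (dilate r B) = dilate r (closure B)"
    using closure_scaleR[of r B] by (simp add: dilate_def)
  ultimately have fr: "frontier (dilate r B) = dilate r (frontier B)"
    using r by (simp add: frontier_def dilate_def image_set_diff inj_on_def)
  have "(\<lambda>x :: real ^ 'a. r *\<^sub>R x) differentiable_on frontier B"
    by (intro linear_imp_differentiable_on) (simp add: linear_scaleR)
  then have "negligible (dilate r (frontier B))"
    unfolding dilate_def using body_negligible_frontier[OF B]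
    by (intro negligible_differentiable_image_negligible) auto
  then show "body (dilate r B)"
    using B r int fr by (simp add: body_def dilate_def bounded_scaling negligible_iff_null_sets)
qed

section \<open>The limit\<close>

text \<open>The loss is measured relative to the volume of the body, so that over any number of
  copies it adds up to the fraction \<open>e\<close> of their total volume.\<close>

lemma uniform_erosion:
  fixes D :: "(real ^ 'n) set set"
  assumes "finite D" and bodies: "\<And>A. A \<in> D \<Longrightarrow> body A" and "0 < e"
  obtains \<rho> where "0 < \<rho>"
    "\<And>A. A \<in> D \<Longrightarrow> (1 - e) * measure lebesgue A \<le> measure lebesgue (erosion \<rho> (interior A))"
proof -
  have "\<forall>\<^sub>F \<rho> in at_right 0. (1 - e) * measure lebesgue A \<le> measure lebesgue (erosion \<rho> (interior A))"
    if A: "A \<in> D" for A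
  proof -
    have "0 < e * measure lebesgue A" using body_measure_pos[OF bodies[OF A]] \<open>0 < e\<close> by simp
    then obtain d where d: "0 < d" "\<And>\<rho>. 0 < \<rho> \<Longrightarrow> \<rho> \<le> d \<Longrightarrow>
        measure lebesgue (interior A) - e * measure lebesgue A < measure lebesgue (erosion \<rho> (interior A))"
      using erosion_exhausts[of "interior A" "e * measure lebesgue A"]
        bounded_interior[OF body_bounded[OF bodies[OF A]]] by auto
    have "(1 - e) * measure lebesgue A \<le> measure lebesgue (erosion \<rho> (interior A))"
      if "0 < \<rho>" "\<rho> < d" for \<rho>
      using d(2)[of \<rho>] that body_measure_interior[OF bodies[OF A]] by (simp add: algebra_simps)
    then show ?thesis using d(1) eventually_at_right_field by blast
  qed
  then have "\<forall>\<^sub>F \<rho> in at_right 0. \<forall>A\<in>D. (1 - e) * measure lebesgue A \<le> measure lebesgue (erosion \<rho> (interior A))"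
    using \<open>finite D\<close> by (simp add: eventually_ball_finite)
  then have "\<forall>\<^sub>F \<rho> in at_right 0. 0 < \<rho> \<and>
      (\<forall>A\<in>D. (1 - e) * measure lebesgue A \<le> measure lebesgue (erosion \<rho> (interior A)))"
    using eventually_at_right_less[of "0::real"] by eventually_elim simp
  then obtain \<rho> where "0 < \<rho>" "\<forall>A\<in>D. (1 - e) * measure lebesgue A \<le> measure lebesgue (erosion \<rho> (interior A))"
    using eventually_happens'[OF trivial_limit_at_right_real] by blast
  then show ?thesis using that by blast
qed

text \<open>A copy is charged to every cell that its interior meets, and all copies charged to one
  cell lie in a cube of side \<open>\<eta> + 2 * (r * b)\<close>. Charging a copy repeatedly only
  increases the bound. Interiors are used because they alone are known to be disjoint from the
  interiors of the large copies.\<close>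

lemma measure_small_copies_le:
  fixes B :: "(real ^ 'n) set" and r :: real
  assumes B: "body B" and \<delta>: "packing_density {B} = ereal \<delta>" and r: "0 < r" and \<eta>: "0 < \<eta>"
    and b: "0 \<le> b" "\<And>x y. x \<in> B \<Longrightarrow> y \<in> B \<Longrightarrow> dist x y \<le> b"
    and Q: "Q \<in> packings {dilate r B}" "finite Q"
    and Z: "finite Z" "\<And>z. cell \<eta> z \<inter> (\<Union>K\<in>Q. interior K) \<noteq> {} \<Longrightarrow> z \<in> Z"
  shows "measure lebesgue (\<Union>Q) \<le> card Z * (\<delta> * (\<eta> + 2 * (r * b)) ^ CARD('n))"
proof -
  define Q' where "Q' z = {K \<in> Q. cell \<eta> z \<inter> interior K \<noteq> {}}" for z
  have rB: "\<And>A. A \<in> {dilate r B} \<Longrightarrow> body A" using body_dilate[OF B r] by simp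
  have Q': "Q' z \<in> packings {dilate r B}" "finite (Q' z)" for z
    using packings_subset[OF Q(1), of "Q' z"] Q(2) by (auto simp: Q'_def)
  have sub: "K \<subseteq> cube (lattice_point \<eta> z) (\<eta> + 2 * (r * b))" if K: "K \<in> Q' z" for K z
  proof
    fix y assume y: "y \<in> K"
    obtain A g where "A \<in> {dilate r B}" and g: "rigid g" "K = g ` A" by (rule packing_member[OF Q'(1) K])
    then have g: "rigid g" "K = g ` dilate r B" by simp_all
    obtain x where x: "x \<in> cell \<eta> z" "x \<in> K"
      using K interior_subset[of K] unfolding Q'_def by blast
    obtain x' y' where xy: "x' \<in> B" "y' \<in> B" "x = g (r *\<^sub>R x')" "y = g (r *\<^sub>R y')"
      using x(2) y g(2) unfolding dilate_def by auto
    have "dist x y = r * dist x' y'"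
      unfolding xy dist_rigid[OF g(1)] using r by (simp add: dist_norm flip: scaleR_diff_right)
    also have "\<dots> \<le> r * b" using b(2)[OF xy(1,2)] r by simp
    finally show "y \<in> cube (lattice_point \<eta> z) (\<eta> + 2 * (r * b))"
      using x(1) unfolding cell_def by (intro cube_near_dist)
  qed
  have m: "measure lebesgue (\<Union>(Q' z)) \<le> \<delta> * (\<eta> + 2 * (r * b)) ^ CARD('n)" for z
    using \<eta> r b(1) by (intro measure_packing_dilate_le[OF B \<delta> r Q' _ sub] add_pos_nonneg) auto
  have meas: "\<Union>(Q' z) \<in> lmeasurable" for z
    by (rule packing_lmeasurable[OF rB Q'])
  have "\<Union>Q \<subseteq> (\<Union>z\<in>Z. \<Union>(Q' z))"
  proof
    fix x assume "x \<in> \<Union>Q"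
    then obtain K where K: "K \<in> Q" "x \<in> K" by blast
    have "body K" by (rule packing_body[OF Q(1) rB K(1)])
    \<comment> \<open>The point \<open>x\<close> may lie on the boundary of \<open>K\<close>, so the
      cell is chosen through an interior point instead.\<close>
    then obtain w where w: "w \<in> interior K" unfolding body_def by blast
    obtain z where z: "w \<in> cell \<eta> z" using cells_cover[OF \<eta>] .
    have "z \<in> Z" using Z(2)[of z] w z K(1) by blast
    moreover have "K \<in> Q' z" using K(1) w z unfolding Q'_def by blast
    ultimately show "x \<in> (\<Union>z\<in>Z. \<Union>(Q' z))" using K(2) by blast
  qed
  then have "measure lebesgue (\<Union>Q) \<le> measure lebesgue (\<Union>z\<in>Z. \<Union>(Q' z))"
    using Z(1) meas packing_lmeasurable[OF rB Q]
    by (intro measure_mono_fmeasurable fmeasurable.finite_UN) (auto simp: fmeasurableD)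
  also have "\<dots> \<le> (\<Sum>z\<in>Z. measure lebesgue (\<Union>(Q' z)))"
    using meas by (intro measure_UNION_le Z(1) fmeasurableD)
  also have "\<dots> \<le> card Z * (\<delta> * (\<eta> + 2 * (r * b)) ^ CARD('n))"
    using sum_bounded_above[of Z "\<lambda>z. measure lebesgue (\<Union>(Q' z))"] m by auto
  finally show ?thesis .
qed

text \<open>A cell meeting the interior of a copy outside \<open>P\<close> has diameter below \<open>\<rho>\<close>, so it misses
  the \<open>\<rho>\<close>-erosion of every member of \<open>P\<close>.\<close>

lemma cells_and_erosions_fit:
  fixes P Q :: "(real ^ 'n) set set" and \<eta> :: real
  assumes P: "finite P" "\<And>K. K \<in> P \<Longrightarrow> K \<subseteq> cube 0 t" and Q: "\<And>L. L \<in> Q \<Longrightarrow> L \<subseteq> cube 0 t"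
    and disj: "\<And>K L. K \<in> P \<union> Q \<Longrightarrow> L \<in> P \<Longrightarrow> K \<noteq> L \<Longrightarrow> interior K \<inter> interior L = {}"
    and PQ: "P \<inter> Q = {}"
    and pos: "0 < t" "0 < \<eta>" "CARD('n) * \<eta> < \<rho>"
  shows "card {z. cell \<eta> z \<inter> (\<Union>L\<in>Q. interior L) \<noteq> {}} * \<eta> ^ CARD('n)
    + (\<Sum>K\<in>P. measure lebesgue (erosion \<rho> (interior K))) \<le> (t + 2 * (CARD('n) * \<eta>)) ^ CARD('n)"
proof -
  let ?n = "CARD('n)"
  let ?W = "\<Union>L\<in>Q. interior L"
  let ?Z = "{z. cell \<eta> z \<inter> ?W \<noteq> {}}"
  \<comment> \<open>The margin \<open>n \<eta>\<close> on each side makes room for cells that stick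
    out of the cube of side \<open>t\<close>.\<close>
  let ?C = "cube 0 (t + 2 * (?n * \<eta>)) :: (real ^ 'n) set"
  let ?Y = "\<Union>K\<in>P. erosion \<rho> (interior K)"
  have \<rho>: "0 < \<rho>" using pos by (smt (verit) mult_nonneg_nonneg of_nat_0_le_iff)
  have W: "?W \<subseteq> cube 0 t" using Q interior_subset by fast
  have fin: "finite ?Z"
    using finite_cells_meeting[OF bounded_subset[OF bounded_cube W] pos(2)] .
  have er: "erosion \<rho> (interior K) \<in> lmeasurable" if "K \<in> P" for K
    using P(2)[OF that] \<rho> by (intro erosion_lmeasurable bounded_interior bounded_subset[OF bounded_cube])
  have Y: "measure lebesgue ?Y = (\<Sum>K\<in>P. measure lebesgue (erosion \<rho> (interior K)))"
  proof (rule measure_negligible_finite_Union_image[OF P(1) er])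
    show "pairwise (\<lambda>K L. negligible (erosion \<rho> (interior K) \<inter> erosion \<rho> (interior L))) P"
    proof (rule pairwiseI)
      fix K L assume "K \<in> P" "L \<in> P" "K \<noteq> L"
      then have "erosion \<rho> (interior K) \<inter> erosion \<rho> (interior L) = {}"
        using disj[of K L] erosion_subset[OF \<rho>] by fast
      then show "negligible (erosion \<rho> (interior K) \<inter> erosion \<rho> (interior L))" by simp
    qed
  qed
  have Ym: "?Y \<in> lmeasurable" using P(1) er by (rule fmeasurable.finite_UN)
  have mono: "cube 0 t \<subseteq> ?C" using pos(1,2) cube_near_dist[where d = "?n * \<eta>"] by fastforce
  have YC: "?Y \<subseteq> ?C"
  proof
    fix x assume "x \<in> ?Y"
    then obtain K where "K \<in> P" "x \<in> interior K" using erosion_subset[OF \<rho>] by fast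
    then show "x \<in> ?C" using P(2) mono interior_subset by fast
  qed
  have "(\<Union>z\<in>?Z. cell \<eta> z) \<subseteq> ?C - ?Y"
  proof
    fix x assume "x \<in> (\<Union>z\<in>?Z. cell \<eta> z)"
    then obtain z L w where z: "x \<in> cell \<eta> z" "w \<in> cell \<eta> z" "L \<in> Q" "w \<in> interior L" by blast
    have d: "dist w x \<le> ?n * \<eta>" using z(1,2) unfolding cell_def by (intro dist_cube)
    have "w \<in> cube 0 t" using z(3,4) W by blast
    then have "x \<in> ?C" using d by (rule cube_near_dist)
    moreover have "x \<notin> erosion \<rho> (interior K)" if K: "K \<in> P" for K
    proof
      assume "x \<in> erosion \<rho> (interior K)"
      moreover have "w \<in> ball x \<rho>" using d pos(3) by (simp add: dist_commute)
      ultimately have "w \<in> interior K" by (auto simp: erosion_def)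
      moreover have "L \<noteq> K" using K z(3) PQ by blast
      ultimately show False using disj[of L K] z(3,4) K by blast
    qed
    ultimately show "x \<in> ?C - ?Y" by blast
  qed
  then have "measure lebesgue (\<Union>z\<in>?Z. cell \<eta> z) \<le> measure lebesgue (?C - ?Y)"
    using fin Ym by (intro measure_mono_fmeasurable fmeasurable.Diff) (auto intro!: fmeasurableD UN_cells_lmeasurable)
  also have "\<dots> = measure lebesgue ?C - measure lebesgue ?Y"
    using YC Ym by (intro measurable_measure_Diff) (auto simp: fmeasurableD)
  finally show ?thesis
    using measure_UN_cells[OF fin, of \<eta>] pos(1,2) Y by (simp add: measure_cube)
qed

text \<open>Here \<open>a\<close> is the volume of the large copies, \<open>N\<close> that of the
  cells used and \<open>T\<close> the available volume. Inserting
  \<open>N \<le> T - (1 - e) * a\<close> leaves \<open>a\<close> with coefficient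
  \<open>1 - \<delta> \<ge> 0\<close>, so the bound on \<open>a\<close> can be inserted too. As
  \<open>(1 + e) (1 - e)\<close> is 1 minus the square of \<open>e\<close>, the error is
  \<open>e T\<close> plus that square times \<open>a\<close>, together at most
  \<open>2 e T\<close>.\<close>

lemma density_upper_estimate:
  fixes a T N \<delta> \<delta>' e :: real
  assumes "a \<le> \<delta>' * T" "\<delta>' \<le> 1" "0 \<le> T" "0 \<le> a" "0 \<le> \<delta>" "\<delta> \<le> 1" "0 \<le> e" "e \<le> 1"
    and "N + (1 - e) * a \<le> T"
  shows "a + \<delta> * (1 + e) * N \<le> (\<delta>' + (1 - \<delta>') * \<delta> + 2 * e) * T"
proof -
  have aT: "a \<le> T" using assms(1,2,3) mult_right_mono[of \<delta>' 1 T] by linarith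
  have ea: "e * (e * a) \<le> e * T"
    using assms aT mult_right_mono[of e 1 a] by (intro mult_left_mono) auto
  have "(1 + e) * N \<le> (1 + e) * (T - (1 - e) * a)"
    using assms by (intro mult_left_mono) auto
  also have "\<dots> = T - a + e * T + e * (e * a)" by (simp add: algebra_simps)
  also have "\<dots> \<le> T - a + 2 * (e * T)" using ea by linarith
  finally have "\<delta> * ((1 + e) * N) \<le> \<delta> * (T - a + 2 * (e * T))"
    using assms(5) by (rule mult_left_mono)
  moreover have "\<delta> * (e * T) \<le> e * T"
    using assms mult_right_mono[of \<delta> 1 "e * T"] by simp
  moreover have "(1 - \<delta>) * a \<le> (1 - \<delta>) * (\<delta>' * T)"
    using assms(1,6) by (intro mult_left_mono) auto
  ultimately show ?thesis by (simp add: algebra_simps)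
qed

lemma packing_density_upper:
  fixes B :: "(real ^ 'n) set" and D :: "(real ^ 'n) set set"
  assumes B: "body B" and D: "finite D" and bodies: "\<And>A. A \<in> D \<Longrightarrow> body A"
    and \<delta>: "packing_density {B} = ereal \<delta>" and \<delta>': "packing_density D = ereal \<delta>'"
    and e: "0 < e" "e \<le> 1"
  shows "\<forall>\<^sub>F r in at_right 0. packing_density ({dilate r B} \<union> D) \<le> ereal (\<delta>' + (1 - \<delta>') * \<delta> + 2 * e)"
proof -
  let ?n = "CARD('n)"
  obtain \<rho> where \<rho>: "0 < \<rho>"
    "\<And>A. A \<in> D \<Longrightarrow> (1 - e) * measure lebesgue A \<le> measure lebesgue (erosion \<rho> (interior A))"
    using uniform_erosion[OF D bodies e(1)] by metis
  \<comment> \<open>The cell diameter bound \<open>n \<eta>\<close> becomes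
    \<open>\<rho> / 2\<close>, strictly below \<rho>.\<close>
  define \<eta> where "\<eta> = \<rho> / (2 * ?n)"
  have \<eta>: "0 < \<eta>" "?n * \<eta> < \<rho>" using \<rho>(1) by (simp_all add: \<eta>_def field_simps)
  define b where "b = diameter B"
  have b: "0 \<le> b" "\<And>x y. x \<in> B \<Longrightarrow> y \<in> B \<Longrightarrow> dist x y \<le> b"
    unfolding b_def using body_bounded[OF B] by (auto simp: diameter_ge_0 diameter_bounded_bound)
  have \<delta>01: "0 \<le> \<delta>" "\<delta> \<le> 1"
    using packing_density_real[of "{B}"] B \<delta> by auto
  have \<delta>'01: "0 \<le> \<delta>'" "\<delta>' \<le> 1"
    using packing_density_real[OF D bodies] \<delta>' by auto
  have "((\<lambda>r. (\<eta> + 2 * (r * b)) ^ ?n) \<longlongrightarrow> (\<eta> + 2 * (0 * b)) ^ ?n) (at_right 0)"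
    by (intro tendsto_intros)
  then have "\<forall>\<^sub>F r in at_right 0. (\<eta> + 2 * (r * b)) ^ ?n < (1 + e) * \<eta> ^ ?n"
    using \<eta>(1) e(1) by (intro order_tendstoD(2)) auto
  with eventually_at_right_less[of "0::real"] show ?thesis
  proof eventually_elim
    fix r :: real assume r: "0 < r" and small: "(\<eta> + 2 * (r * b)) ^ ?n < (1 + e) * \<eta> ^ ?n"
    let ?E = "{dilate r B} \<union> D"
    have E: "\<And>A. A \<in> ?E \<Longrightarrow> body A" using body_dilate[OF B r] bodies by auto
    show "packing_density ?E \<le> ereal (\<delta>' + (1 - \<delta>') * \<delta> + 2 * e)"
    \<comment> \<open>This slack is the enlargement of the cube that contains all cells meeting
      it.\<close>
    proof (rule packing_density_le[OF _ E, where c = "2 * (?n * \<eta>)"])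
      fix P t assume P: "P \<in> packings ?E" "finite P" and t: "0 < t" and sub: "\<And>K. K \<in> P \<Longrightarrow> K \<subseteq> cube 0 t"
      \<comment> \<open>A copy congruent both to \<open>dilate r B\<close> and to a body of
        \<open>D\<close> is counted as large, so that the two families are disjoint.\<close>
      define PD where "PD = {K \<in> P. \<exists>A\<in>D. congruent_copy K A}"
      define Q where "Q = P - PD"
      define T where "T = (t + 2 * (?n * \<eta>)) ^ ?n"
      have PQ: "P = PD \<union> Q" "PD \<inter> Q = {}" by (auto simp: PD_def Q_def)
      have fin: "finite PD" "finite Q" using P(2) by (simp_all add: PD_def Q_def)
      have PD: "PD \<in> packings D"
        using packing_interior_disjoint[OF P(1)] by (intro packingsI) (auto simp: PD_def)
      have Q: "Q \<in> packings {dilate r B}"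
      proof (rule packingsI)
        fix K assume "K \<in> Q"
        then show "\<exists>A\<in>{dilate r B}. congruent_copy K A"
          using packing_congruent[OF P(1), of K] by (auto simp: PD_def Q_def)
      qed (use packing_interior_disjoint[OF P(1)] in \<open>auto simp: Q_def\<close>)
      define a where "a = measure lebesgue (\<Union>PD)"
      let ?Z = "{z. cell \<eta> z \<inter> (\<Union>L\<in>Q. interior L) \<noteq> {}}"
      have tT: "t ^ ?n \<le> T" unfolding T_def using t \<eta>(1) by (intro power_mono) auto
      have "ereal (a / t ^ ?n) \<le> ereal \<delta>'"
        unfolding a_def \<delta>'[symmetric] using PQ(1) sub
        by (intro packing_density_ge[OF bodies PD fin(1) t]) auto
      then have a: "a \<le> \<delta>' * T"
        using t mult_left_mono[OF tT \<delta>'01(1)] by (simp add: field_simps)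
      have asum: "a = (\<Sum>K\<in>PD. measure lebesgue K)"
        unfolding a_def by (rule measure_packing[OF bodies PD fin(1)])
      have "(1 - e) * a = (\<Sum>K\<in>PD. (1 - e) * measure lebesgue K)"
        by (simp add: asum sum_distrib_left)
      also have "\<dots> \<le> (\<Sum>K\<in>PD. measure lebesgue (erosion \<rho> (interior K)))"
      proof (rule sum_mono)
        fix K assume K: "K \<in> PD"
        obtain A g where A: "A \<in> D" "rigid g" "K = g ` A" by (rule packing_member[OF PD K])
        have "measure lebesgue (erosion \<rho> (interior K)) = measure lebesgue (erosion \<rho> (interior A))"
          unfolding A(3) interior_rigid_image[OF A(2)]
          using body_bounded[OF bodies[OF A(1)]] \<rho>(1) A(2)
          by (intro measure_erosion_rigid_image bounded_interior)
        then show "(1 - e) * measure lebesgue K \<le> measure lebesgue (erosion \<rho> (interior K))"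
          using \<rho>(2)[OF A(1)] measure_rigid_image_body[OF bodies[OF A(1)] A(2)] A(3) by simp
      qed
      finally have er: "(1 - e) * a \<le> (\<Sum>K\<in>PD. measure lebesgue (erosion \<rho> (interior K)))" .
      have "card ?Z * \<eta> ^ ?n + (\<Sum>K\<in>PD. measure lebesgue (erosion \<rho> (interior K))) \<le> T"
        unfolding T_def
      proof (rule cells_and_erosions_fit[OF fin(1) _ _ _ PQ(2) t \<eta>])
        fix K L assume "K \<in> PD \<union> Q" "L \<in> PD" "K \<noteq> L"
        then show "interior K \<inter> interior L = {}"
          using PQ(1) by (intro packing_interior_disjoint[OF P(1)]) auto
      qed (use PQ(1) sub in auto)
      with er have fit: "card ?Z * \<eta> ^ ?n + (1 - e) * a \<le> T" by linarith
      have finZ: "finite ?Z"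
      proof (rule finite_cells_meeting[OF _ \<eta>(1)])
        show "bounded (\<Union>L\<in>Q. interior L)"
        proof (rule bounded_subset[OF bounded_cube[of 0 t]])
          show "(\<Union>L\<in>Q. interior L) \<subseteq> cube 0 t"
            using PQ(1) sub interior_subset by fast
        qed
      qed
      have "measure lebesgue (\<Union>Q) \<le> card ?Z * (\<delta> * (\<eta> + 2 * (r * b)) ^ ?n)"
        by (rule measure_small_copies_le[OF B \<delta> r \<eta>(1) b Q fin(2) finZ]) auto
      also have "\<dots> \<le> card ?Z * (\<delta> * ((1 + e) * \<eta> ^ ?n))"
        using small \<delta>01(1) by (intro mult_left_mono) auto
      finally have Qle: "measure lebesgue (\<Union>Q) \<le> \<delta> * (1 + e) * (card ?Z * \<eta> ^ ?n)"
        by (simp add: ac_simps)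
      have "measure lebesgue (\<Union>P) \<le> a + measure lebesgue (\<Union>Q)"
        unfolding a_def PQ(1) Union_Un_distrib
        using packing_lmeasurable[OF bodies PD fin(1)] packing_lmeasurable[OF _ Q fin(2)] body_dilate[OF B r]
        by (intro measure_Un_le) (auto simp: fmeasurableD)
      also have "\<dots> \<le> (\<delta>' + (1 - \<delta>') * \<delta> + 2 * e) * T"
        using density_upper_estimate[OF a \<delta>'01(2) _ _ \<delta>01 _ e(2) fit] Qle t \<eta>(1) e(1)
        by (simp add: T_def a_def)
      finally show "measure lebesgue (\<Union>P) \<le> (\<delta>' + (1 - \<delta>') * \<delta> + 2 * e) * (t + 2 * (?n * \<eta>)) ^ ?n"
        by (simp add: T_def)
    qed (use D in simp)
  qed
qed

section \<open>Lower bound for the limit\<close>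

text \<open>\<alpha> and \<beta> are the densities reached by the two finite packings. Their
  shortfalls below \<delta>' and \<delta> cost at most \<open>e\<close> each, since the coefficients
  \<open>1 - \<beta>\<close> and \<open>1 - \<delta>'\<close> lie between 0 and 1 where they are
  used; the volume lost to erosion costs at most \<open>\<beta> * e \<le> e\<close>.\<close>

lemma density_lower_estimate:
  fixes \<alpha> \<beta> \<delta> \<delta>' e :: real
  assumes "\<delta>' - e \<le> \<alpha>" "\<delta> - e \<le> \<beta>" "0 \<le> \<beta>" "\<beta> \<le> 1" "0 \<le> \<delta>'" "\<delta>' \<le> 1" "0 \<le> e"
  shows "\<delta>' + (1 - \<delta>') * \<delta> - 3 * e \<le> \<alpha> + \<beta> * (1 - \<alpha> - e)"
proof -
  have "(1 - \<beta>) * (\<delta>' - e) \<le> (1 - \<beta>) * \<alpha>" using assms by (intro mult_left_mono) auto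
  then have 1: "\<delta>' - e - \<beta> * \<delta>' + \<beta> * e \<le> \<alpha> - \<beta> * \<alpha>" by (simp add: algebra_simps)
  have "(1 - \<delta>') * (\<delta> - e) \<le> (1 - \<delta>') * \<beta>" using assms by (intro mult_left_mono) auto
  then have 2: "\<delta> - e - \<delta>' * \<delta> + \<delta>' * e \<le> \<beta> - \<beta> * \<delta>'" by (simp add: algebra_simps)
  have "0 \<le> \<delta>' * e" using assms by simp
  with 1 2 have "\<delta>' + \<delta> - \<delta>' * \<delta> - 3 * e \<le> \<alpha> + \<beta> - \<beta> * \<alpha> - \<beta> * e" using assms(7) by linarith
  then show ?thesis by (simp add: algebra_simps)
qed

lemma packing_density_lower:
  fixes B :: "(real ^ 'n) set" and D :: "(real ^ 'n) set set"
  assumes B: "body B" and D: "finite D" and bodies: "\<And>A. A \<in> D \<Longrightarrow> body A"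
    and \<delta>: "packing_density {B} = ereal \<delta>" and \<delta>': "packing_density D = ereal \<delta>'"
    and e: "0 < e"
  shows "\<forall>\<^sub>F r in at_right 0. ereal (\<delta>' + (1 - \<delta>') * \<delta> - 3 * e) \<le> packing_density ({dilate r B} \<union> D)"
proof -
  let ?n = "CARD('n)"
  have Bs: "\<And>A. A \<in> {B} \<Longrightarrow> body A" using B by simp
  have \<delta>01: "\<delta> \<le> 1"
    using packing_density_real[of "{B}"] B \<delta> by auto
  have \<delta>'01: "0 \<le> \<delta>'" "\<delta>' \<le> 1"
    using packing_density_real[OF D bodies] \<delta>' by auto
  obtain P s where P: "P \<in> packings D" "finite P" and s: "0 < s"
    and Psub: "\<And>K. K \<in> P \<Longrightarrow> K \<subseteq> cube 0 s" and Pdense: "(\<delta>' - e) * s ^ ?n < measure lebesgue (\<Union>P)"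
    using dense_packing_exists[OF D bodies \<delta>' e] by metis
  obtain Q t where Q: "Q \<in> packings {B}" "finite Q" and t: "0 < t"
    and Qsub: "\<And>K. K \<in> Q \<Longrightarrow> K \<subseteq> cube 0 t" and Qdense: "(\<delta> - e) * t ^ ?n < measure lebesgue (\<Union>Q)"
    using dense_packing_exists[OF _ Bs \<delta> e] by (metis finite.emptyI finite.insertI)
  define a where "a = measure lebesgue (\<Union>P)"
  define \<beta> where "\<beta> = measure lebesgue (\<Union>Q) / t ^ ?n"
  have \<beta>: "\<delta> - e \<le> \<beta>" "0 \<le> \<beta>" unfolding \<beta>_def using Qdense t by (simp_all add: field_simps)
  have "ereal \<beta> \<le> ereal \<delta>"
    unfolding \<beta>_def \<delta>[symmetric] by (rule packing_density_ge[OF Bs Q t Qsub])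
  then have \<beta>1: "\<beta> \<le> 1" using \<delta>01 by simp
  \<comment> \<open>Removing closures makes the free region open, as the erosion argument requires.
    The volume is unchanged because frontiers of bodies are null.\<close>
  define C where "C = (\<Union>K\<in>P. closure K)"
  define U where "U = interior (cube 0 s) - C"
  have PC: "\<Union>P \<subseteq> C" using closure_subset unfolding C_def by fast
  have bd: "bounded K" if "K \<in> P" for K using packing_body[OF P(1) bodies that] body_bounded by blast
  have Ccl: "closed C" unfolding C_def using P(2) by auto
  have Cm: "C \<in> lmeasurable" unfolding C_def using P(2) bd by (intro fmeasurable.finite_UN lmeasurable_closure)
  have Uopen: "open U" unfolding U_def using Ccl by auto
  have Usub: "U \<subseteq> cube 0 s" unfolding U_def using interior_subset by blast
  have Ubd: "bounded U" by (rule bounded_subset[OF bounded_cube Usub])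
  have Um: "U \<in> lmeasurable" using Uopen Ubd by (simp add: lmeasurable_open)
  have "measure lebesgue C \<le> (\<Sum>K\<in>P. measure lebesgue (closure K))"
    unfolding C_def using P(2) bd by (intro measure_UNION_le fmeasurableD lmeasurable_closure)
  also have "\<dots> = (\<Sum>K\<in>P. measure lebesgue K)"
    using packing_body[OF P(1) bodies] by (intro sum.cong body_measure_closure) auto
  also have "\<dots> = a" unfolding a_def by (rule measure_packing[OF bodies P, symmetric])
  finally have Ca: "measure lebesgue C \<le> a" .
  have "s ^ ?n = measure lebesgue (interior (cube 0 s) :: (real ^ 'n) set)"
    using measure_interior[OF bounded_cube negligible_frontier_cube, of "0 :: real ^ 'n" s] s by (simp add: measure_cube)
  also have "\<dots> \<le> measure lebesgue (U \<union> C)"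
    by (intro measure_mono_fmeasurable fmeasurable.Un Um Cm) (auto simp: U_def)
  also have "\<dots> \<le> measure lebesgue U + measure lebesgue C"
    using Um Cm by (intro measure_Un_le fmeasurableD)
  finally have Uge: "s ^ ?n - a \<le> measure lebesgue U" using Ca by linarith
  have "0 < e * s ^ ?n" using e s by simp
  then obtain d where d: "0 < d" "measure lebesgue U - e * s ^ ?n < measure lebesgue (erosion d U)"
    using erosion_exhausts[OF Uopen Ubd, of "e * s ^ ?n"] by auto
  \<comment> \<open>Both finite packings, and hence \<open>d\<close> and \<open>t\<close>, are fixed
    before \<open>r\<close>; only the scale of the filling depends on \<open>r\<close>.\<close>
  have "((\<lambda>r. ?n * (r * t)) \<longlongrightarrow> ?n * (0 * t)) (at_right 0)"
    by (intro tendsto_intros)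
  then have "\<forall>\<^sub>F r in at_right 0. ?n * (r * t) < d"
    using d(1) by (intro order_tendstoD(2)) auto
  with eventually_at_right_less[of "0::real"] show ?thesis
  proof eventually_elim
    fix r :: real assume r: "0 < r" and small: "?n * (r * t) < d"
    let ?E = "{dilate r B} \<union> D" and ?g = "\<lambda>x :: real ^ 'n. r *\<^sub>R x + 0"
    have rB: "\<And>A. A \<in> {dilate r B} \<Longrightarrow> body A" using body_dilate[OF B r] by simp
    have E: "\<And>A. A \<in> ?E \<Longrightarrow> body A" using rB bodies by auto
    \<comment> \<open>Dilation by \<open>r\<close> shrinks the cube of side \<open>t\<close>
      containing \<open>Q\<close> to exactly one grid cell.\<close>
    define h where "h = r * t"
    have h: "0 < h" unfolding h_def using r t by simp
    define Z where "Z = {z. cell h z \<subseteq> U}"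
    have finZ: "finite Z" unfolding Z_def by (rule finite_cells_inside[OF Ubd h])
    have Zge: "s ^ ?n - a - e * s ^ ?n \<le> card Z * h ^ ?n"
      using measure_erosion_le_cells[OF Ubd h, of d] small d(2) Uge by (simp add: Z_def h_def)
    define Qr where "Qr = (\<lambda>K. ?g ` K) ` Q"
    have Qr: "Qr \<in> packings {dilate r B}"
      using packings_affine_image[OF Q(1) r, of 0] by (simp add: Qr_def)
    have finQr: "finite Qr" using Q(2) by (simp add: Qr_def)
    have Qrsub: "K \<subseteq> cube 0 h" if K: "K \<in> Qr" for K
    proof -
      obtain L where L: "L \<in> Q" "K = ?g ` L" using K by (auto simp: Qr_def)
      have "?g ` L \<subseteq> ?g ` cube 0 t" by (intro image_mono Qsub L(1))
      then show ?thesis unfolding L(2) h_def using r by (subst (asm) cube_affine_image) simp_all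
    qed
    have UQr: "\<Union>Qr = ?g ` \<Union>Q" by (simp add: Qr_def image_Union)
    have "measure lebesgue (\<Union>Qr) = r ^ ?n * measure lebesgue (\<Union>Q)"
      unfolding UQr using measure_lebesgue_affine[of r "0 :: real ^ 'n" "\<Union>Q"] r by simp
    then have mQr: "measure lebesgue (\<Union>Qr) = \<beta> * h ^ ?n"
      using t by (simp add: \<beta>_def h_def power_mult_distrib)
    define S where "S = tile h Qr Z"
    have S: "S \<in> packings {dilate r B}" unfolding S_def by (rule tile_packing[OF Qr Qrsub])
    have finS: "finite S" unfolding S_def tile_def using finZ finQr by blast
    have mS: "measure lebesgue (\<Union>S) = card Z * (\<beta> * h ^ ?n)"
      unfolding S_def mQr[symmetric]
      by (rule measure_tile[OF finZ packing_lmeasurable[OF rB Qr finQr] Qrsub])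
    have SU: "L \<subseteq> U" if L: "L \<in> S" for L
    proof -
      obtain z where "z \<in> Z" "L \<subseteq> cell h z"
        using tile_member_subset_cell[OF Qrsub] L unfolding S_def by metis
      then show ?thesis by (auto simp: Z_def)
    qed
    \<comment> \<open>The filling avoids even the closures of the members of \<open>P\<close>, so
      the carriers are disjoint and their volumes add exactly.\<close>
    have PS: "K \<inter> L = {}" if "K \<in> P" "L \<in> S" for K L
      using SU[OF that(2)] that(1) PC unfolding U_def by blast
    have PSp: "P \<union> S \<in> packings ?E"
    proof (rule packings_Un)
      show "P \<in> packings ?E" using P(1) by (rule packings_mono) auto
      show "S \<in> packings ?E" using S by (rule packings_mono) auto
      fix K L assume "K \<in> P" "L \<in> S"
      then show "interior K \<inter> interior L = {}"
        using PS[of K L] interior_subset[of K] interior_subset[of L] by blast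
    qed
    have "measure lebesgue (\<Union>(P \<union> S)) = a + measure lebesgue (\<Union>S)"
    proof -
      have Pm: "\<Union>P \<in> lmeasurable" by (rule packing_lmeasurable[OF bodies P])
      have Sm: "\<Union>S \<in> lmeasurable" by (rule packing_lmeasurable[OF rB S finS])
      have "\<Union>P \<inter> \<Union>S = {}" using PS by blast
      then show ?thesis
        using measure_Un3[OF Pm Sm] by (simp add: a_def)
    qed
    then have m: "measure lebesgue (\<Union>(P \<union> S)) / s ^ ?n = (a + \<beta> * (card Z * h ^ ?n)) / s ^ ?n"
      by (simp add: mS ac_simps)
    have "\<delta>' + (1 - \<delta>') * \<delta> - 3 * e \<le> a / s ^ ?n + \<beta> * (1 - a / s ^ ?n - e)"
      using Pdense s \<beta> \<beta>1 \<delta>'01 e by (intro density_lower_estimate) (auto simp: a_def field_simps)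
    also have "\<dots> = (a + \<beta> * (s ^ ?n - a - e * s ^ ?n)) / s ^ ?n"
      using s by (simp add: field_simps)
    also have "\<dots> \<le> (a + \<beta> * (card Z * h ^ ?n)) / s ^ ?n"
      using s \<beta>(2) Zge by (intro divide_right_mono add_left_mono mult_left_mono) auto
    finally have "ereal (\<delta>' + (1 - \<delta>') * \<delta> - 3 * e) \<le> ereal (measure lebesgue (\<Union>(P \<union> S)) / s ^ ?n)"
      unfolding m by simp
    also have "\<dots> \<le> packing_density ?E"
    proof (rule packing_density_ge[OF E PSp _ s])
      fix K assume "K \<in> P \<union> S"
      then show "K \<subseteq> cube 0 s" using Psub SU Usub by blast
    qed (use P(2) finS in simp_all)
    finally show "ereal (\<delta>' + (1 - \<delta>') * \<delta> - 3 * e) \<le> packing_density ?E" .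
  qed
qed

theorem theorem4p2:
  fixes B :: "(real ^ 'n) set" and D :: "(real ^ 'n) set set"
  assumes "body B"
    and "finite D"
    and "\<And>A. A \<in> D \<Longrightarrow> body A"
  shows "((\<lambda>r. packing_density ({dilate r B} \<union> D)) \<longlongrightarrow>
           packing_density D + (1 - packing_density D) * packing_density {B}) (at_right 0)"
proof -
  obtain \<delta>' where \<delta>': "packing_density D = ereal \<delta>'"
    using packing_density_real[OF assms(2,3)] by metis
  obtain \<delta> where \<delta>: "packing_density {B} = ereal \<delta>"
    using packing_density_real[of "{B}"] assms(1) by auto
  define L where "L = \<delta>' + (1 - \<delta>') * \<delta>"
  have "((\<lambda>r. packing_density ({dilate r B} \<union> D)) \<longlongrightarrow> ereal L) (at_right 0)"
  proof (rule order_tendstoI)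
    fix y assume y: "y < ereal L"
    \<comment> \<open>For real \<open>y\<close> a sixth of the gap makes \<open>3 * e\<close> half
      of it; for \<open>y\<close> equal to minus infinity any positive \<open>e\<close> will
      do.\<close>
    obtain e where e: "0 < e" "y < ereal (L - 3 * e)"
    proof (cases y)
      case (real y')
      then show ?thesis using y by (intro that[of "(L - y') / 6"]) (auto simp: field_simps)
    qed (use y that[of 1] in auto)
    show "\<forall>\<^sub>F r in at_right 0. y < packing_density ({dilate r B} \<union> D)"
      using packing_density_lower[OF assms \<delta> \<delta>' e(1)] e(2) unfolding L_def
      by (auto elim!: eventually_mono)
  next
    fix y assume y: "ereal L < y"
    \<comment> \<open>The cap 1 meets the condition \<open>e \<le> 1\<close> of the upper bound; a
      quarter of the gap keeps \<open>2 * e\<close> within half of it.\<close>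
    obtain e where e: "0 < e" "e \<le> 1" "ereal (L + 2 * e) < y"
    proof (cases y)
      case (real y')
      then show ?thesis using y by (intro that[of "min 1 ((y' - L) / 4)"]) (auto simp: field_simps min_def)
    qed (use y that[of 1] in auto)
    show "\<forall>\<^sub>F r in at_right 0. packing_density ({dilate r B} \<union> D) < y"
      using packing_density_upper[OF assms \<delta> \<delta>' e(1,2)] e(3) unfolding L_def
      by (auto elim!: eventually_mono)
  qed
  then show ?thesis by (simp add: \<delta> \<delta>' L_def one_ereal_def)
qed

end
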